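(* For all integers $d,m\ge1$ there exist constants $C_{m,d}>0$ and $C'_{m,d}>0$ such that for all $B>0$ and $n\ge1$: if $C_{m,d}Bn^{-m/d}>1$ then $e^{\mathrm{ad\text{-}stoch}}_n(\mathcal F_{d,m,B},S_{\mathrm{samp}},D_{\sup\text{-}\log})\le C'_{m,d}Bn^{-m/d}$, and if $C_{m,d}Bn^{-m/d}\le 1$ then $e^{\mathrm{ad\text{-}stoch}}_n(\mathcal F_{d,m,B},S_{\mathrm{samp}},D_{\sup\text{-}\log})\le C'_{m,d}(C_{m,d}Bn^{-m/d})^{n/2+1}$.
   Context: Let $\mathcal X=[0,1]^d$ with Lebesgue measure. For bounded measurable $f:\mathcal X\to\mathbb R$ let $Z_f=\int_{\mathcal X}e^{f}dx$ and $P_f$ the distribution with density $e^f/Z_f$; $S_{\mathrm{samp}}(f)=P_f$. For $f\in C^m(\mathcal X)$, $\|f\|_{C^m}=\sup_{|\alpha|_1\le m}\|\partial^\alpha f\|_\infty$, $\mathcal F_{d,m,B}=\{f\in C^m(\mathcal X):\|f\|_{C^m}\le B\}$. Sup-log distance: $D_{\sup\text{-}\log}(P,Q)=\|\log(dP/dQ)\|_\infty$ (essential sup over $\mathcal X$), $=\infty$ unless $P,Q$ are mutually absolutely continuous. Stochastic sampling algorithms: given a probability space $(\Omega,P_\Omega)$, a random sample has the form $X_f(\omega)=\tilde\phi(N(f,\omega),\omega)\in\mathcal X$, where $N(f,\omega)=(f(x_1),\dots,f(x_n))$ with each point $x_k$ allowed to depend on $\omega$ and on $f(x_1),\dots,f(x_{k-1})$;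 the associated map $\tilde S$ sends $f$ to the distribution of $X_f(\omega)$ for $\omega\sim P_\Omega$. $\mathcal A^{\mathrm{ad\text{-}stoch}}_n$ is the set of all such $\tilde S$ using $n$ evaluations, and $e^{\mathrm{ad\text{-}stoch}}_n(\mathcal F,S_{\mathrm{samp}},D)=\inf_{\tilde S\in\mathcal A^{\mathrm{ad\text{-}stoch}}_n}\sup_{f\in\mathcal F}D(P_f,\tilde S(f))$. *)

theory Defs
  imports "HOL-Probability.Probability"
begin

definition cube :: "(real ^ 'd) set" where
  "cube = {x. \<forall>i. 0 \<le> x $ i \<and> x $ i \<le> 1}"

text \<open>Multi-indices are functions alpha :: 'd => nat, of order sum alpha UNIV.
  A family g of functions indexed by multi-indices is the family of partial
  derivatives of f up to order m on the cube: g 0 = f, every g alpha with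
  order <= m is continuous on the cube, and for order < m, the partial
  derivative of g alpha in coordinate direction i (one-sided at the boundary,
  i.e. within the cube) is g (alpha + e_i).\<close>
definition Cm_derivs :: "nat \<Rightarrow> (real ^ 'd \<Rightarrow> real) \<Rightarrow> (('d \<Rightarrow> nat) \<Rightarrow> real ^ 'd \<Rightarrow> real) \<Rightarrow> bool" where
  "Cm_derivs m f g \<longleftrightarrow>
     g (\<lambda>_. 0) = f \<and>
     (\<forall>\<alpha>. sum \<alpha> UNIV \<le> m \<longrightarrow> continuous_on cube (g \<alpha>)) \<and>
     (\<forall>\<alpha> i. sum \<alpha> UNIV < m \<longrightarrow> (\<forall>x\<in>cube.
        ((\<lambda>t. g \<alpha> (x + t *\<^sub>R axis i 1)) has_real_derivative g (\<alpha>(i := \<alpha> i + 1)) x)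
          (at 0 within {t. x + t *\<^sub>R axis i 1 \<in> cube})))"

definition Fclass :: "nat \<Rightarrow> real \<Rightarrow> (real ^ 'd \<Rightarrow> real) set" where
  "Fclass m B = {f. \<exists>g. Cm_derivs m f g \<and>
       (\<forall>\<alpha>. sum \<alpha> UNIV \<le> m \<longrightarrow> (\<forall>x\<in>cube. \<bar>g \<alpha> x\<bar> \<le> B))}"

definition Zf :: "(real ^ 'd \<Rightarrow> real) \<Rightarrow> real" where
  "Zf f = (LINT x : cube | lborel. exp (f x))"

definition Pf :: "(real ^ 'd \<Rightarrow> real) \<Rightarrow> (real ^ 'd) measure" where
  "Pf f = density lborel (\<lambda>x. ennreal (indicator cube x * exp (f x) / Zf f))"

definition D_suplog :: "'a measure \<Rightarrow> 'a measure \<Rightarrow> ereal" where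
  "D_suplog P Q =
    (if absolutely_continuous Q P \<and> absolutely_continuous P Q
     then esssup Q (\<lambda>x. ereal \<bar>ln (enn2real (RN_deriv Q P x))\<bar>)
     else \<infinity>)"

text \<open>Adaptive stochastic algorithms with n function evaluations.
  psi k omega ys is the (k+1)-st evaluation point, chosen from omega and the
  previously observed values ys = [f x_1, ..., f x_k]; phi maps the observed
  information and omega to the sample.\<close>
type_synonym omega = "nat \<Rightarrow> real"

fun info :: "(nat \<Rightarrow> omega \<Rightarrow> real list \<Rightarrow> real ^ 'd) \<Rightarrow> (real ^ 'd \<Rightarrow> real) \<Rightarrow> omega \<Rightarrow> nat \<Rightarrow> real list" where
  "info \<psi> f \<omega> 0 = []"
| "info \<psi> f \<omega> (Suc k) = info \<psi> f \<omega> k @ [f (\<psi> k \<omega> (info \<psi> f \<omega> k))]"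

definition sample :: "nat \<Rightarrow> (nat \<Rightarrow> omega \<Rightarrow> real list \<Rightarrow> real ^ 'd) \<Rightarrow> (real list \<Rightarrow> omega \<Rightarrow> real ^ 'd) \<Rightarrow> (real ^ 'd \<Rightarrow> real) \<Rightarrow> omega \<Rightarrow> real ^ 'd" where
  "sample n \<psi> \<phi> f \<omega> = \<phi> (info \<psi> f \<omega> n) \<omega>"

definition ad_stoch_alg :: "nat \<Rightarrow> omega measure \<Rightarrow> (nat \<Rightarrow> omega \<Rightarrow> real list \<Rightarrow> real ^ 'd) \<Rightarrow> (real list \<Rightarrow> omega \<Rightarrow> real ^ 'd) \<Rightarrow> bool" where
  "ad_stoch_alg n M \<psi> \<phi> \<longleftrightarrow>
     prob_space M \<and>
     (\<forall>k \<omega> ys. \<psi> k \<omega> ys \<in> cube) \<and>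
     (\<forall>ys \<omega>. \<phi> ys \<omega> \<in> cube) \<and>
     (\<forall>f. f \<in> borel_measurable borel \<longrightarrow> sample n \<psi> \<phi> f \<in> measurable M borel)"

definition alg_dist :: "nat \<Rightarrow> omega measure \<Rightarrow> (nat \<Rightarrow> omega \<Rightarrow> real list \<Rightarrow> real ^ 'd) \<Rightarrow> (real list \<Rightarrow> omega \<Rightarrow> real ^ 'd) \<Rightarrow> (real ^ 'd \<Rightarrow> real) \<Rightarrow> (real ^ 'd) measure" where
  "alg_dist n M \<psi> \<phi> f = distr M lborel (sample n \<psi> \<phi> f)"

definition err_ad_stoch :: "nat \<Rightarrow> (real ^ 'd \<Rightarrow> real) set \<Rightarrow> ereal" where
  "err_ad_stoch n F =
     (INF A \<in> {(M, \<psi>, \<phi>). ad_stoch_alg n M \<psi> \<phi>}.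
        (case A of (M, \<psi>, \<phi>) \<Rightarrow> SUP f \<in> F. D_suplog (Pf f) (alg_dist n M \<psi> \<phi> f)))"

end

theory Submission
  imports Defs "HOL-Computational_Algebra.Polynomial"
begin

text \<open>At most half of the evaluations are spent on a regular grid; two members of the class that
  nearly agree on the grid are within \<open>\<epsilon> = O(B n\<^bsup>-m/d\<^esup>)\<close> of each other on the whole cube, so any member
  \<open>g\<close> consistent with the observed values approximates \<open>f\<close> up to \<open>\<epsilon>\<close>. The remaining \<open>k \<ge> n/2\<close>
  evaluations are spent on rejection sampling: propose from \<open>P\<^sub>g\<close>, accept with probability
  \<open>exp (f - g - \<epsilon>)\<close>, and return a fresh proposal if all \<open>k\<close> attempts fail. A single attempt fails with
  probability \<open>p \<le> 2\<epsilon>\<close>, so the output has law \<open>(1 - p\<^sup>k) P\<^sub>f + p\<^sup>k P\<^sub>g\<close>. Since \<open>P\<^sub>g\<close> has density between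
  \<open>exp (-2\<epsilon>)\<close> and \<open>exp (2\<epsilon>)\<close> with respect to \<open>P\<^sub>f\<close>, the sup-log distance is at most \<open>2\<epsilon>\<close>, and at most
  \<open>6 (2\<epsilon>)\<^bsup>k+1\<^esup>\<close> if \<open>2\<epsilon> \<le> 1\<close>.\<close>

section \<open>Approximation from grid values\<close>

text \<open>The interpolant \<open>q\<close> through the \<open>m\<close> distinct nodes agrees with
  \<open>p\<close> there and both have degree below \<open>m\<close>, so \<open>p = q\<close>. The
  weights are the Lagrange basis polynomials evaluated at 0.\<close>

lemma Lagrange_interpolation_at_0:
  fixes p :: "'a::field poly" and w :: "nat \<Rightarrow> 'a"
  assumes deg: "degree p < m" and inj: "inj_on w {..<m}"
  shows "poly p 0 = (\<Sum>i<m. poly p (w i) * (\<Prod>j\<in>{..<m} - {i}. w j / (w j - w i)))"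
proof -
  define l where "l i = (\<Prod>j\<in>{..<m} - {i}. smult (1 / (w j - w i)) [:w j, -1:])" for i
  define q where "q = (\<Sum>i<m. smult (poly p (w i)) (l i))"
  have poly_l: "poly (l i) x = (\<Prod>j\<in>{..<m} - {i}. (w j - x) / (w j - w i))" for i x
    by (simp add: l_def poly_prod diff_divide_distrib)
  have deg_l: "degree (l i) < m" if "i < m" for i
  proof -
    have "degree (l i) \<le> (\<Sum>j\<in>{..<m} - {i}. degree (smult (1 / (w j - w i)) [:w j, -1:]))"
      unfolding l_def by (rule order.trans[OF degree_prod_sum_le]) (auto simp: o_def)
    also have "\<dots> \<le> (\<Sum>j\<in>{..<m} - {i}. 1)"
      by (intro sum_mono) (auto intro: order.trans[OF degree_smult_le])
    also have "\<dots> < m" using that by simp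
    finally show ?thesis .
  qed
  have "degree q < m"
    unfolding q_def
    by (rule degree_sum_less) (use deg deg_l in \<open>auto intro: le_less_trans[OF degree_smult_le]\<close>)
  moreover have "poly q (w k) = poly p (w k)" if "k < m" for k
  proof -
    have "poly (l i) (w k) = (if i = k then 1 else 0)" if "i < m" for i
    proof (cases "i = k")
      case True
      have "(\<Prod>j\<in>{..<m} - {i}. (w j - w k) / (w j - w i)) = (\<Prod>j\<in>{..<m} - {i}. 1)"
        using True inj that by (intro prod.cong) (auto simp: inj_on_def)
      then show ?thesis using True by (simp add: poly_l)
    next
      case False
      then show ?thesis using \<open>k < m\<close> by (auto simp: poly_l)
    qed
    then have "poly q (w k) = (\<Sum>i<m. poly p (w i) * (if i = k then 1 else 0))"
      by (simp add: q_def poly_sum)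
    also have "\<dots> = poly p (w k)" using that by (simp add: if_distrib cong: if_cong)
    finally show ?thesis .
  qed
  moreover have *: "poly q 0 = (\<Sum>i<m. poly p (w i) * (\<Prod>j\<in>{..<m} - {i}. w j / (w j - w i)))"
    by (simp add: q_def poly_sum poly_l)
  ultimately have "p = q"
    using deg inj by (intro poly_eqI_degree[of "w ` {..<m}"]) (auto simp: card_image)
  then show ?thesis using * by simp
qed

text \<open>The Taylor polynomial centred at \<open>t\<close> equals \<open>D 0 t\<close> there and is nearly bounded by \<open>A\<close>
  at the \<open>m\<close> grid points next to \<open>t\<close>, so Lagrange interpolation bounds its value at \<open>t\<close>.\<close>
lemma bound_from_grid_values:
  fixes D :: "nat \<Rightarrow> real \<Rightarrow> real"
  assumes m: "1 \<le> m" "m \<le> J"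
    and deriv: "\<And>r x. r < m \<Longrightarrow> x \<in> {0..1} \<Longrightarrow> (D r has_real_derivative D (Suc r) x) (at x within {0..1})"
    and bound: "\<And>x. x \<in> {0..1} \<Longrightarrow> \<bar>D m x\<bar> \<le> E"
    and grid: "\<And>i. i < J \<Longrightarrow> \<bar>D 0 (real i / real J)\<bar> \<le> A"
    and t: "t \<in> {0..1}"
  shows "\<bar>D 0 t\<bar> \<le> real m ^ Suc m * (A + E * (real m / real J) ^ m)"
proof -
  have J: "real J > 0" using m by simp
  \<comment> \<open>The nodes used are \<open>i0, ..., i0 + m - 1\<close> in units of
    \<open>1 / J\<close>. The minimum with \<open>J - m\<close> keeps their indices below
    \<open>J\<close>. Near 1 the interpolation therefore extrapolates, but every node stays within
    \<open>m / J\<close> of \<open>t\<close>.\<close>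
  define i0 where "i0 = min (nat \<lfloor>t * real J\<rfloor>) (J - m)"
  have i0: "i0 + m \<le> J" using m by (simp add: i0_def)
  have tJ: "real i0 \<le> t * real J" "t * real J \<le> real i0 + real m"
  proof -
    have "real (nat \<lfloor>t * real J\<rfloor>) \<le> t * real J" using t by simp
    then show "real i0 \<le> t * real J" by (simp add: i0_def min_def)
    have "t * real J \<le> real J" using t J by (simp add: mult_left_le_one_le)
    moreover have "t * real J \<le> real (nat \<lfloor>t * real J\<rfloor>) + 1" using t by linarith
    ultimately show "t * real J \<le> real i0 + real m" using m
      by (simp add: i0_def min_def of_nat_diff)
  qed
  define x where "x i = real (i0 + i) / real J" for i
  \<comment> \<open>Shifting the nodes by \<open>t\<close> turns the value at \<open>t\<close> into
    interpolation at 0.\<close>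
  define w where "w i = x i - t" for i
  have x01: "x i \<in> {0..1}" if "i < m" for i
    using that i0 J by (auto simp: x_def field_simps)
  have w_le: "\<bar>w i\<bar> \<le> real m / real J" if "i < m" for i
  proof -
    have "\<bar>real (i0 + i) - t * real J\<bar> \<le> real m" using tJ that by (auto simp: abs_le_iff)
    then have "\<bar>(real (i0 + i) - t * real J) / real J\<bar> \<le> real m / real J"
      using J by (simp add: divide_right_mono)
    then show ?thesis using J by (simp add: w_def x_def diff_divide_distrib)
  qed
  have E: "E \<ge> 0" using bound[OF t] by linarith
  define p where "p = (\<Sum>r<m. monom (D r t / fact r) r)"
  have p: "poly p y = (\<Sum>r<m. D r t * y ^ r / fact r)" for y
    by (simp add: p_def poly_sum poly_monom)
  have "degree p < m"
    unfolding p_def using m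
    by (intro degree_sum_less) (auto intro: le_less_trans[OF degree_monom_le])
  moreover have "inj_on w {..<m}" using J by (auto simp: inj_on_def w_def x_def field_simps)
  ultimately have "poly p 0 = (\<Sum>i<m. poly p (w i) * (\<Prod>j\<in>{..<m} - {i}. w j / (w j - w i)))"
    by (rule Lagrange_interpolation_at_0)
  moreover have "poly p 0 = D 0 t"
    using m by (simp add: p power_0_left if_distrib if_distribR cong: if_cong)
  ultimately have eq: "D 0 t = (\<Sum>i<m. poly p (w i) * (\<Prod>j\<in>{..<m} - {i}. w j / (w j - w i)))"
    by simp
  have node: "\<bar>poly p (w i)\<bar> \<le> A + E * (real m / real J) ^ m" if "i < m" for i
  proof -
    have "norm (D 0 (x i) - (\<Sum>r\<le>m - 1. D r t * (x i - t) ^ r / fact r))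
      \<le> E * norm (x i - t) ^ Suc (m - 1) / fact (m - 1)"
      by (rule field_Taylor[of "{0..1}"]) (use m deriv bound t x01[OF that] in auto)
    also have "\<dots> \<le> E * norm (x i - t) ^ Suc (m - 1) / 1"
      using E by (intro divide_left_mono) (auto simp: fact_ge_1)
    also have "\<dots> = E * \<bar>w i\<bar> ^ m" using m by (simp add: w_def)
    also have "\<dots> \<le> E * (real m / real J) ^ m"
      using E w_le[OF that] by (intro mult_left_mono power_mono) auto
    finally have "\<bar>D 0 (x i) - (\<Sum>r\<le>m - 1. D r t * (x i - t) ^ r / fact r)\<bar> \<le> E * (real m / real J) ^ m"
      by simp
    moreover have "{..m - 1} = {..<m}" using m by auto
    ultimately have "\<bar>D 0 (x i) - poly p (w i)\<bar> \<le> E * (real m / real J) ^ m"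
      by (simp add: p w_def)
    moreover have "\<bar>D 0 (x i)\<bar> \<le> A" using grid[of "i0 + i"] that i0 by (simp add: x_def)
    ultimately show ?thesis by linarith
  qed
  \<comment> \<open>Each numerator is at most \<open>m / J\<close> and distinct nodes are at least
    \<open>1 / J\<close> apart, so each of the \<open>m - 1\<close> factors is at most
    \<open>m\<close>, whatever the mesh.\<close>
  have quot: "\<bar>\<Prod>j\<in>{..<m} - {i}. w j / (w j - w i)\<bar> \<le> real m ^ m" if "i < m" for i
  proof -
    have "\<bar>\<Prod>j\<in>{..<m} - {i}. w j / (w j - w i)\<bar> = (\<Prod>j\<in>{..<m} - {i}. \<bar>w j / (w j - w i)\<bar>)"
      by (simp add: abs_prod)
    also have "\<dots> \<le> (\<Prod>j\<in>{..<m} - {i}. real m)"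
    proof (intro prod_mono conjI)
      fix j assume j: "j \<in> {..<m} - {i}"
      have "w j - w i = (real j - real i) / real J"
        by (simp add: w_def x_def diff_divide_distrib add_divide_distrib)
      moreover have "\<bar>real j - real i\<bar> \<ge> 1" using j by auto
      ultimately have "\<bar>w j - w i\<bar> \<ge> 1 / real J" using J by (simp add: divide_right_mono)
      then have "\<bar>w j\<bar> \<le> real m * \<bar>w j - w i\<bar>"
        using w_le[of j] j mult_left_mono[of "1 / real J" "\<bar>w j - w i\<bar>" "real m"] by auto
      moreover have "\<bar>w j - w i\<bar> > 0" using \<open>\<bar>w j - w i\<bar> \<ge> 1 / real J\<close> J
        by (smt (verit) divide_pos_pos)
      ultimately show "\<bar>w j / (w j - w i)\<bar> \<le> real m" by (simp add: abs_divide divide_le_eq)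
    qed simp
    also have "\<dots> = real m ^ (m - 1)" using that by simp
    also have "\<dots> \<le> real m ^ m" using m by (intro power_increasing) auto
    finally show ?thesis .
  qed
  have "\<bar>D 0 t\<bar> \<le> (\<Sum>i<m. \<bar>poly p (w i) * (\<Prod>j\<in>{..<m} - {i}. w j / (w j - w i))\<bar>)"
    unfolding eq by (rule sum_abs)
  also have "\<dots> \<le> (\<Sum>i<m. (A + E * (real m / real J) ^ m) * real m ^ m)"
    unfolding abs_mult
    by (intro sum_mono mult_mono node quot) (use node in force)+
  finally show ?thesis by (simp add: mult_ac)
qed

section \<open>The smoothness class and its restriction to coordinate lines\<close>

lemma Fclass_diff:
  fixes f g :: "real ^ 'd \<Rightarrow> real"
  assumes "f \<in> Fclass m B" "g \<in> Fclass m B"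
  shows "(\<lambda>x. f x - g x) \<in> Fclass m (2 * B)"
proof -
  from assms obtain F G where F: "Cm_derivs m f F" "\<And>\<alpha> x. sum \<alpha> UNIV \<le> m \<Longrightarrow> x \<in> cube \<Longrightarrow> \<bar>F \<alpha> x\<bar> \<le> B"
    and G: "Cm_derivs m g G" "\<And>\<alpha> x. sum \<alpha> UNIV \<le> m \<Longrightarrow> x \<in> cube \<Longrightarrow> \<bar>G \<alpha> x\<bar> \<le> B"
    unfolding Fclass_def by blast
  have "Cm_derivs m (\<lambda>x. f x - g x) (\<lambda>\<alpha> x. F \<alpha> x - G \<alpha> x)"
    using F(1) G(1) unfolding Cm_derivs_def
    by (auto intro!: continuous_on_diff DERIV_diff)
  moreover have "\<bar>F \<alpha> x - G \<alpha> x\<bar> \<le> 2 * B" if "sum \<alpha> UNIV \<le> m" "x \<in> cube" for \<alpha> x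
    using F(2)[OF that] G(2)[OF that] by linarith
  ultimately show ?thesis unfolding Fclass_def by blast
qed

lemma Fclass_bound:
  assumes "f \<in> Fclass m B" "x \<in> cube"
  shows "\<bar>f x\<bar> \<le> B"
  using assms unfolding Fclass_def Cm_derivs_def by fastforce

lemma Fclass_continuous:
  assumes "f \<in> Fclass m B"
  shows "continuous_on cube f"
  using assms unfolding Fclass_def Cm_derivs_def by fastforce

text \<open>Reduces to one variable: the derivatives along a line in direction \<open>j\<close> are
  the partial derivatives whose multi-index is concentrated on \<open>j\<close>.\<close>

lemma Fclass_line_derivs:
  fixes f :: "real ^ 'd \<Rightarrow> real"
  assumes f: "f \<in> Fclass m B" and x: "x \<in> cube"
  shows "\<exists>D. D 0 = (\<lambda>\<tau>. f (\<chi> i. if i = j then \<tau> else x $ i)) \<and>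
    (\<forall>r<m. \<forall>\<tau>\<in>{0..1}. (D r has_real_derivative D (Suc r) \<tau>) (at \<tau> within {0..1})) \<and>
    (\<forall>\<tau>\<in>{0..1}. \<bar>D m \<tau>\<bar> \<le> B)"
proof -
  from f obtain F where F: "Cm_derivs m f F" "\<And>\<alpha> x. sum \<alpha> UNIV \<le> m \<Longrightarrow> x \<in> cube \<Longrightarrow> \<bar>F \<alpha> x\<bar> \<le> B"
    unfolding Fclass_def by blast
  define y where "y \<tau> = (\<chi> i. if i = j then \<tau> else x $ i)" for \<tau>
  define \<alpha> where "\<alpha> r = (\<lambda>i. if i = j then r else 0)" for r :: nat
  have sum_\<alpha>: "sum (\<alpha> r) UNIV = r" for r by (simp add: \<alpha>_def)
  have \<alpha>_Suc: "(\<alpha> r)(j := \<alpha> r j + 1) = \<alpha> (Suc r)" for r by (auto simp: \<alpha>_def)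
  have y_cube: "y \<tau> \<in> cube \<longleftrightarrow> \<tau> \<in> {0..1}" for \<tau>
    using x by (auto simp: y_def cube_def)
  have y_shift: "y \<tau> + t *\<^sub>R axis j 1 = y (t + \<tau>)" for \<tau> t
    by (simp add: y_def vec_eq_iff axis_def)
  show ?thesis
  proof (intro exI[of _ "\<lambda>r \<tau>. F (\<alpha> r) (y \<tau>)"] conjI allI impI ballI)
    show "(\<lambda>\<tau>. F (\<alpha> 0) (y \<tau>)) = (\<lambda>\<tau>. f (\<chi> i. if i = j then \<tau> else x $ i))"
      using F(1) by (simp add: Cm_derivs_def y_def \<alpha>_def)
    show "\<bar>F (\<alpha> m) (y \<tau>)\<bar> \<le> B" if "\<tau> \<in> {0..1}" for \<tau>
      using that by (intro F(2)) (auto simp: y_cube sum_\<alpha>)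
    fix r \<tau> assume r: "r < m" and \<tau>: "\<tau> \<in> {0..1::real}"
    have "((\<lambda>t. F (\<alpha> r) (y \<tau> + t *\<^sub>R axis j 1)) has_real_derivative F ((\<alpha> r)(j := \<alpha> r j + 1)) (y \<tau>))
        (at 0 within {t. y \<tau> + t *\<^sub>R axis j 1 \<in> cube})"
      using F(1) r \<tau> y_cube sum_\<alpha> unfolding Cm_derivs_def by metis
    \<comment> \<open>The admissible increments at \<open>\<tau>\<close> form the unit interval
      shifted by \<open>- \<tau>\<close>. The chain rule for that shift moves the derivative from 0
      to \<open>\<tau>\<close>.\<close>
    then have *: "((\<lambda>t. F (\<alpha> r) (y (t + \<tau>))) has_real_derivative F (\<alpha> (Suc r)) (y \<tau>))
        (at (\<tau> - \<tau>) within (\<lambda>\<sigma>. \<sigma> - \<tau>) ` {0..1})"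
      unfolding \<alpha>_Suc y_shift y_cube by (rule back_subst) (auto simp: image_iff intro!: arg_cong2[where f = "at_within"] bexI[of _ "_ + \<tau>"])
    have "((\<lambda>t. F (\<alpha> r) (y (t + \<tau>))) \<circ> (\<lambda>\<sigma>. \<sigma> - \<tau>) has_real_derivative F (\<alpha> (Suc r)) (y \<tau>) * 1)
        (at \<tau> within {0..1})"
      by (rule DERIV_image_chain[OF *]) (auto intro!: derivative_eq_intros)
    then show "((\<lambda>\<tau>. F (\<alpha> r) (y \<tau>)) has_real_derivative F (\<alpha> (Suc r)) (y \<tau>)) (at \<tau> within {0..1})"
      by (simp add: o_def)
  qed
qed

section \<open>Regular grids and the choice of evaluation nodes\<close>

definition grid :: "nat \<Rightarrow> (real ^ 'd) set" where
  "grid J = {x. \<forall>i. x $ i \<in> (\<lambda>k. real k / real J) ` {..<J}}"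

lemma grid_subset_cube: "grid J \<subseteq> (cube :: (real ^ 'd) set)"
proof
  fix x :: "real ^ 'd" assume x: "x \<in> grid J"
  have "0 \<le> x $ i \<and> x $ i \<le> 1" for i
  proof -
    obtain k where "k < J" "x $ i = real k / real J" using x by (auto simp: grid_def)
    then show ?thesis by simp
  qed
  then show "x \<in> cube" by (simp add: cube_def)
qed

lemma finite_grid: "finite (grid J :: (real ^ 'd) set)"
  and card_grid_le: "card (grid J :: (real ^ 'd) set) \<le> J ^ CARD('d)"
proof -
  let ?G = "(\<lambda>k. real k / real J) ` {..<J}"
  have eq: "(grid J :: (real ^ 'd) set) = vec_lambda ` (UNIV \<rightarrow>\<^sub>E ?G)"
  proof (intro set_eqI iffI)
    fix x :: "real ^ 'd" assume "x \<in> grid J"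
    then show "x \<in> vec_lambda ` (UNIV \<rightarrow>\<^sub>E ?G)"
      by (intro image_eqI[of _ _ "vec_nth x"]) (auto simp: grid_def)
  qed (auto simp: grid_def PiE_iff)
  have fin: "finite ((UNIV :: 'd set) \<rightarrow>\<^sub>E ?G)" by (intro finite_PiE) auto
  then show "finite (grid J :: (real ^ 'd) set)" unfolding eq by (rule finite_imageI)
  have "card (grid J :: (real ^ 'd) set) \<le> card ((UNIV :: 'd set) \<rightarrow>\<^sub>E ?G)"
    unfolding eq using fin by (rule card_image_le)
  also have "\<dots> = card ?G ^ CARD('d)" by (simp add: card_PiE)
  also have "\<dots> \<le> J ^ CARD('d)" using card_image_le[of "{..<J}"] by (intro power_mono) auto
  finally show "card (grid J :: (real ^ 'd) set) \<le> J ^ CARD('d)" .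
qed

text \<open>Freeing one coordinate at a time from the grid needs only the pure derivatives of order \<open>m\<close>.\<close>
lemma Fclass_bound_from_grid:
  fixes f :: "real ^ 'd \<Rightarrow> real"
  assumes m: "1 \<le> m" "m \<le> J" and f: "f \<in> Fclass m E" and E: "0 \<le> E"
    and A: "\<And>x. x \<in> grid J \<Longrightarrow> \<bar>f x\<bar> \<le> A" and x: "x \<in> cube"
  shows "\<bar>f x\<bar> \<le> (2 * real m ^ Suc m) ^ CARD('d) * (A + E * (real m / real J) ^ m)"
proof -
  let ?\<Lambda> = "real m ^ Suc m" and ?E = "E * (real m / real J) ^ m"
  have \<Lambda>: "?\<Lambda> \<ge> 1" using m by (intro one_le_power) auto
  have "(\<chi> i. 0) \<in> grid J" using m by (force simp: grid_def)
  then have A0: "A \<ge> 0" using A by force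
  have E0: "?E \<ge> 0" using E by simp
  \<comment> \<open>Induction over the set \<open>S\<close> of coordinates that may be arbitrary;
    all others lie on the grid. Each freed coordinate costs a factor
    \<open>2 * ?\<Lambda>\<close>.\<close>
  have "\<bar>f x\<bar> \<le> (2 * ?\<Lambda>) ^ card S * (A + ?E)"
    if "finite S" "x \<in> cube" "\<And>i. i \<notin> S \<Longrightarrow> x $ i \<in> (\<lambda>k. real k / real J) ` {..<J}" for S x
    using that
  proof (induction S arbitrary: x rule: finite_induct)
    case empty
    then have "x \<in> grid J" by (simp add: grid_def)
    then show ?case using A[of x] E0 by simp
  next
    case (insert j S)
    obtain D where D: "D 0 = (\<lambda>\<tau>. f (\<chi> i. if i = j then \<tau> else x $ i))"
      "\<And>r \<tau>. r < m \<Longrightarrow> \<tau> \<in> {0..1} \<Longrightarrow> (D r has_real_derivative D (Suc r) \<tau>) (at \<tau> within {0..1})"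
      "\<And>\<tau>. \<tau> \<in> {0..1} \<Longrightarrow> \<bar>D m \<tau>\<bar> \<le> E"
      using Fclass_line_derivs[OF f insert.prems(1), of j] by blast
    have node: "\<bar>D 0 (real k / real J)\<bar> \<le> (2 * ?\<Lambda>) ^ card S * (A + ?E)" if "k < J" for k
      unfolding D(1)
    proof (rule insert.IH)
      show "(\<chi> i. if i = j then real k / real J else x $ i) \<in> cube"
        using insert.prems(1) that by (auto simp: cube_def field_simps)
      show "(\<chi> i. if i = j then real k / real J else x $ i) $ i \<in> (\<lambda>k. real k / real J) ` {..<J}"
        if "i \<notin> S" for i
        using that insert.prems(2)[of i] \<open>k < J\<close> by auto
    qed
    have xj: "x $ j \<in> {0..1}" using insert.prems(1) by (simp add: cube_def)
    have "(\<chi> i. if i = j then x $ j else x $ i) = x" by (simp add: vec_eq_iff)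
    then have "\<bar>f x\<bar> = \<bar>D 0 (x $ j)\<bar>" by (simp add: D(1))
    also have "\<dots> \<le> ?\<Lambda> * ((2 * ?\<Lambda>) ^ card S * (A + ?E) + ?E)"
      by (rule bound_from_grid_values[OF m D(2,3) node xj])
    \<comment> \<open>The additional remainder \<open>?E\<close> is at most the bound already
      reached for \<open>S\<close>; this is the source of the factor 2.\<close>
    also have "\<dots> \<le> ?\<Lambda> * ((2 * ?\<Lambda>) ^ card S * (A + ?E) + (2 * ?\<Lambda>) ^ card S * (A + ?E))"
    proof (intro mult_left_mono add_left_mono)
      have "1 * ?E \<le> (2 * ?\<Lambda>) ^ card S * (A + ?E)"
        using \<Lambda> A0 E0 by (intro mult_mono one_le_power) auto
      then show "?E \<le> (2 * ?\<Lambda>) ^ card S * (A + ?E)" by simp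
    qed (use \<Lambda> in auto)
    also have "\<dots> = (2 * ?\<Lambda>) ^ card (insert j S) * (A + ?E)"
      using insert.hyps by (simp add: algebra_simps)
    finally show ?case .
  qed
  from this[of UNIV x] x show ?thesis by simp
qed

text \<open>Raising the bound on \<open>n\<close> to the power \<open>m / d\<close> compares the
  target rate with the mesh: \<open>n\<close> to the power \<open>- m / d\<close> is at least a
  constant times \<open>(J + 1)\<close> to the power \<open>- m\<close>.\<close>

lemma one_le_power_mult_powr_minus:
  assumes "1 \<le> n" "0 < d" "n < (2 * (J + 1)) ^ d"
  shows "1 \<le> (2 * (real J + 1)) ^ m * real n powr (- real m / real d)"
proof -
  have "real n < real ((2 * (J + 1)) ^ d)" using assms(3) by (simp only: of_nat_less_iff)
  then have "real n < (2 * (real J + 1)) ^ d" by (simp add: add.commute)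
  then have "real n powr (real m / real d) \<le> ((2 * (real J + 1)) ^ d) powr (real m / real d)"
    using assms by (intro powr_mono2) auto
  also have "\<dots> = (2 * (real J + 1)) ^ m"
    using assms(2) by (simp add: powr_powr flip: powr_realpow)
  finally show ?thesis using assms(1) by (simp add: powr_minus divide_simps)
qed

text \<open>The finest grid using at most half the evaluations has mesh of order \<open>n\<close> to
  the power \<open>- 1 / d\<close>, which gives the rate if it has at least \<open>m\<close> points
  per axis. Otherwise \<open>n\<close> is bounded in terms of \<open>m\<close> and \<open>d\<close>,
  and the trivial bound \<open>2 * B\<close> has the right order without any node. The tolerance in
  the node values leaves room for rounding them.\<close>

lemma Fclass_sampling_nodes:
  assumes m: "1 \<le> m"
  obtains c :: real where "c > 0"
    "\<And>B n. B > 0 \<Longrightarrow> n \<ge> 1 \<Longrightarrow> \<exists>xs :: (real ^ 'd) list. 2 * length xs \<le> n \<and> set xs \<subseteq> cube \<and>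
      (\<forall>f \<in> Fclass m B. \<forall>g \<in> Fclass m B.
        (\<forall>x \<in> set xs. \<bar>f x - g x\<bar> \<le> B * real n powr (- real m / real CARD('d))) \<longrightarrow>
        (\<forall>x \<in> cube. \<bar>f x - g x\<bar> \<le> c * (B * real n powr (- real m / real CARD('d)))))"
proof -
  let ?d = "CARD('d)"
  \<comment> \<open>The first summand serves the case \<open>m \<le> J\<close>, the second the case
    \<open>J < m\<close>.\<close>
  define c where "c = (2 * real m ^ Suc m) ^ ?d * (1 + 2 * (4 * real m) ^ m) + 2 * (2 * real m) ^ m"
  have "c > 0" using m unfolding c_def by (intro add_pos_nonneg mult_pos_pos add_pos_nonneg) auto
  moreover have "\<exists>xs :: (real ^ 'd) list. 2 * length xs \<le> n \<and> set xs \<subseteq> cube \<and>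
      (\<forall>f \<in> Fclass m B. \<forall>g \<in> Fclass m B.
        (\<forall>x \<in> set xs. \<bar>f x - g x\<bar> \<le> B * real n powr (- real m / real ?d)) \<longrightarrow>
        (\<forall>x \<in> cube. \<bar>f x - g x\<bar> \<le> c * (B * real n powr (- real m / real ?d))))"
    if B: "B > 0" and n: "n \<ge> 1" for B n
  proof -
    define q where "q = real n powr (- real m / real ?d)"
    have q: "q > 0" using n by (simp add: q_def)
    have le: "j \<le> n" if "2 * j ^ ?d \<le> n" for j :: nat
    proof (cases "j = 0")
      case False
      then have "j \<le> j ^ ?d" by (intro self_le_power) auto
      then show ?thesis using that by linarith
    qed simp
    \<comment> \<open>For \<open>n = 1\<close> this gives \<open>J = 0\<close>, which falls under
      the case \<open>J < m\<close>.\<close>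
    define J where "J = Max {j. 2 * j ^ ?d \<le> n}"
    have fin: "finite {j. 2 * j ^ ?d \<le> n}" by (rule finite_subset[of _ "{..n}"]) (use le in blast, simp)
    have "0 \<in> {j. 2 * j ^ ?d \<le> n}" by (simp add: power_0_left)
    then have J: "2 * J ^ ?d \<le> n" using Max_in[OF fin] by (auto simp: J_def)
    have "\<not> 2 * (J + 1) ^ ?d \<le> n"
    proof
      assume "2 * (J + 1) ^ ?d \<le> n"
      then have "J + 1 \<le> J" unfolding J_def by (intro Max_ge fin) auto
      then show False by simp
    qed
    moreover have "2 * (J + 1) ^ ?d \<le> (2 * (J + 1)) ^ ?d"
      unfolding power_mult_distrib by (intro mult_right_mono self_le_power) auto
    ultimately have "n < (2 * (J + 1)) ^ ?d" by simp
    then have Jq: "1 \<le> (2 * (real J + 1)) ^ m * q"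
      unfolding q_def using n by (intro one_le_power_mult_powr_minus) auto
    show ?thesis
    proof (cases "m \<le> J")
      case False
      have "\<bar>f x - g x\<bar> \<le> c * (B * q)" if "f \<in> Fclass m B" "g \<in> Fclass m B" "x \<in> cube" for f g :: "real ^ 'd \<Rightarrow> real" and x
      proof -
        have "\<bar>f x - g x\<bar> \<le> 2 * B" using Fclass_bound[OF that(1,3)] Fclass_bound[OF that(2,3)] by linarith
        also have "\<dots> \<le> 2 * B * ((2 * (real J + 1)) ^ m * q)" using Jq B by simp
        also have "\<dots> \<le> 2 * B * ((2 * real m) ^ m * q)"
          using False B q by (intro mult_left_mono mult_right_mono power_mono) auto
        also have "\<dots> = (2 * (2 * real m) ^ m) * (B * q)" by simp
        also have "\<dots> \<le> c * (B * q)" using B q by (intro mult_right_mono) (auto simp: c_def)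
        finally show ?thesis .
      qed
      then show ?thesis by (intro exI[of _ "[]"]) (auto simp: q_def)
    next
      case True
      obtain xs :: "(real ^ 'd) list" where xs: "set xs = grid J" "length xs = card (grid J :: (real ^ 'd) set)"
        using finite_distinct_list[OF finite_grid] distinct_card by metis
      have "2 * length xs \<le> n" using card_grid_le[of J, where 'd = 'd] J xs(2) by linarith
      moreover have "\<bar>f x - g x\<bar> \<le> c * (B * q)"
        if "f \<in> Fclass m B" "g \<in> Fclass m B" "\<forall>x\<in>set xs. \<bar>f x - g x\<bar> \<le> B * q" "x \<in> cube" for f g :: "real ^ 'd \<Rightarrow> real" and x
      proof -
        have "1 \<le> (4 * real J) ^ m * q"
          using Jq power_mono[of "2 * (real J + 1)" "4 * real J" m] True m q
          by (smt (verit) mult_right_mono of_nat_1 of_nat_mono)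
        then have "(real m / real J) ^ m * 1 \<le> (real m / real J) ^ m * ((4 * real J) ^ m * q)"
          by (intro mult_left_mono) auto
        also have "\<dots> = (4 * real m) ^ m * q"
          using True m by (simp add: power_divide power_mult_distrib)
        finally have h: "(real m / real J) ^ m \<le> (4 * real m) ^ m * q" by simp
        have "\<bar>f x - g x\<bar> \<le> (2 * real m ^ Suc m) ^ ?d * (B * q + (2 * B) * (real m / real J) ^ m)"
          by (rule Fclass_bound_from_grid[OF m True Fclass_diff[OF that(1,2)]])
            (use that xs B in auto)
        also have "\<dots> \<le> (2 * real m ^ Suc m) ^ ?d * (B * q + (2 * B) * ((4 * real m) ^ m * q))"
          using h B by (intro mult_left_mono add_left_mono) auto
        also have "\<dots> = ((2 * real m ^ Suc m) ^ ?d * (1 + 2 * (4 * real m) ^ m)) * (B * q)"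
          by (simp add: algebra_simps)
        also have "\<dots> \<le> c * (B * q)" using B q by (intro mult_right_mono) (auto simp: c_def)
        finally show ?thesis .
      qed
      ultimately show ?thesis using xs grid_subset_cube[of J, where 'd = 'd]
        by (intro exI[of _ xs]) (auto simp: q_def)
    qed
  qed
  ultimately show ?thesis using that by blast
qed

section \<open>Rejection sampling\<close>

text \<open>\<open>w\<close> is a stream of proposals paired with auxiliary variables. After
  \<open>k\<close> rejections the next proposal is returned untested: it is independent of the
  failed attempts and costs no evaluation.\<close>

fun rejection :: "('a \<times> 'b \<Rightarrow> bool) \<Rightarrow> nat \<Rightarrow> (nat \<Rightarrow> 'a \<times> 'b) \<Rightarrow> 'a" where
  "rejection acc 0 w = fst (w 0)"
| "rejection acc (Suc k) w =
    (if acc (w 0) then fst (w 0) else rejection acc k (\<lambda>i. w (Suc i)))"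

abbreviation unif01 :: "real measure" where
  "unif01 \<equiv> uniform_measure lborel {0..1}"

lemma prob_space_unif01: "prob_space unif01"
  by (rule prob_space_uniform_measure) auto

lemma emeasure_unif01_atMost:
  assumes "0 \<le> a" "a \<le> 1"
  shows "emeasure unif01 {..a} = ennreal a"
proof -
  have "{0..1} \<inter> {..a} = {0..a}" using assms by auto
  then show ?thesis using assms by (simp add: emeasure_uniform_measure divide_ennreal flip: ennreal_1)
qed

lemma emeasure_unif01_greaterThan:
  assumes "0 \<le> a" "a \<le> 1"
  shows "emeasure unif01 {a<..} = ennreal (1 - a)"
proof -
  have "{0..1} \<inter> {a<..} = {a<..1}" using assms by auto
  then show ?thesis using assms by (simp add: emeasure_uniform_measure divide_ennreal flip: ennreal_1)
qed

lemma measurable_shift_seq: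
  "(\<lambda>w i. w (Suc i)) \<in> measurable (\<Pi>\<^sub>M i\<in>UNIV::nat set. M) (\<Pi>\<^sub>M i\<in>UNIV::nat set. M)"
  by (rule measurable_PiM_single') (auto simp: space_PiM PiE_iff)

lemma measurable_rejection:
  assumes acc: "Measurable.pred (P \<Otimes>\<^sub>M N) acc"
  shows "rejection acc k \<in> measurable (\<Pi>\<^sub>M i\<in>UNIV. P \<Otimes>\<^sub>M N) P"
proof (induction k)
  case 0
  show ?case by (simp add: measurable_component_singleton)
next
  case (Suc k)
  note [measurable] = acc Suc measurable_shift_seq
  have [measurable]: "(\<lambda>w. rejection acc k (\<lambda>i. w (Suc i))) \<in> measurable (\<Pi>\<^sub>M i\<in>UNIV. P \<Otimes>\<^sub>M N) P"
    by (rule measurable_compose[OF measurable_shift_seq Suc])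
  show ?case unfolding rejection.simps by measurable
qed

text \<open>Conditioning on the first pair: it is accepted with probability \<open>a x\<close>, and
  otherwise the shifted stream, independent of it and of the same law, is used with one attempt
  fewer.\<close>

lemma rejection_distr_step:
  assumes P: "prob_space P" and a[measurable]: "a \<in> borel_measurable P"
    and a01: "\<And>x. 0 \<le> a x" "\<And>x. a x \<le> 1" and A[measurable]: "A \<in> sets P"
  defines "Q \<equiv> \<lambda>k. distr (\<Pi>\<^sub>M i\<in>UNIV. P \<Otimes>\<^sub>M unif01) P (rejection (\<lambda>(x, u). u \<le> a x) k)"
  shows "emeasure (Q (Suc k)) A =
    (\<integral>\<^sup>+x\<in>A. ennreal (a x) \<partial>P) + (\<integral>\<^sup>+x. ennreal (1 - a x) \<partial>P) * emeasure (Q k) A"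
proof -
  let ?M = "P \<Otimes>\<^sub>M unif01" and ?acc = "\<lambda>(x, u). u \<le> a x"
  let ?S = "\<Pi>\<^sub>M i\<in>UNIV::nat set. ?M"
  interpret P0: prob_space P by fact
  interpret U: prob_space unif01 by (rule prob_space_unif01)
  interpret PU: pair_prob_space P unif01 ..
  interpret S: sequence_space ?M ..
  have acc[measurable]: "Measurable.pred ?M ?acc" by measurable
  note [measurable] = measurable_rejection[OF acc]
  have Q: "emeasure (Q k) A = emeasure ?S {w \<in> space ?S. rejection ?acc k w \<in> A}" for k
    unfolding Q_def by (subst emeasure_distr) (auto intro!: arg_cong2[where f = emeasure])
  have [measurable]: "{w \<in> space ?S. rejection ?acc k w \<in> A} \<in> sets ?S" for k by measurable
  have [measurable]: "(\<lambda>(s, \<omega>). case_nat s \<omega>) \<in> measurable (?M \<Otimes>\<^sub>M ?S) ?S" by measurable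
  \<comment> \<open>Prepending an independent pair to an i.i.d. sequence reproduces the law of the
    sequence; this splits off the first attempt.\<close>
  have "emeasure (Q (Suc k)) A = emeasure (distr (?M \<Otimes>\<^sub>M ?S) ?S (\<lambda>(s, \<omega>). case_nat s \<omega>))
      {w \<in> space ?S. rejection ?acc (Suc k) w \<in> A}"
    by (simp only: Q S.PiM_iter)
  also have "\<dots> = emeasure (?M \<Otimes>\<^sub>M ?S) {z \<in> space (?M \<Otimes>\<^sub>M ?S).
      (if ?acc (fst z) then fst (fst z) \<in> A else rejection ?acc k (snd z) \<in> A)}"
    by (subst emeasure_distr, measurable) (auto intro!: arg_cong2[where f = emeasure]
        simp: space_pair_measure space_PiM PiE_iff split: nat.splits if_splits)
  also have "\<dots> = (\<integral>\<^sup>+s. emeasure ?S {w \<in> space ?S. if ?acc s then fst s \<in> A else rejection ?acc k w \<in> A} \<partial>?M)"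
    by (subst S.P.emeasure_pair_measure_alt, measurable)
      (auto intro!: nn_integral_cong arg_cong2[where f = emeasure] simp: space_pair_measure)
  also have "\<dots> = (\<integral>\<^sup>+s. (if ?acc s then indicator A (fst s) else emeasure (Q k) A) \<partial>?M)"
    by (intro nn_integral_cong) (auto simp: Q S.P.emeasure_space_1 indicator_def)
  also have "\<dots> = (\<integral>\<^sup>+x. \<integral>\<^sup>+u. (if u \<le> a x then indicator A x else emeasure (Q k) A) \<partial>unif01 \<partial>P)"
    by (subst U.nn_integral_fst[symmetric]) (auto simp: split_beta' cong: if_cong)
  also have "\<dots> = (\<integral>\<^sup>+x. ennreal (a x) * indicator A x + ennreal (1 - a x) * emeasure (Q k) A \<partial>P)"
  proof (intro nn_integral_cong)
    fix x
    have "(\<integral>\<^sup>+u. (if u \<le> a x then indicator A x else emeasure (Q k) A) \<partial>unif01) =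
      (\<integral>\<^sup>+u. indicator A x * indicator {..a x} u + emeasure (Q k) A * indicator {a x<..} u \<partial>unif01)"
      by (intro nn_integral_cong) (auto simp: indicator_def)
    also have "\<dots> = indicator A x * emeasure unif01 {..a x} + emeasure (Q k) A * emeasure unif01 {a x<..}"
      by (subst nn_integral_add) (auto simp: nn_integral_cmult)
    finally show "(\<integral>\<^sup>+u. (if u \<le> a x then indicator A x else emeasure (Q k) A) \<partial>unif01) =
      ennreal (a x) * indicator A x + ennreal (1 - a x) * emeasure (Q k) A"
      by (simp only: emeasure_unif01_atMost[OF a01] emeasure_unif01_greaterThan[OF a01] mult.commute)
  qed
  also have "\<dots> = (\<integral>\<^sup>+x\<in>A. ennreal (a x) \<partial>P) + (\<integral>\<^sup>+x. ennreal (1 - a x) \<partial>P) * emeasure (Q k) A"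
    by (subst nn_integral_add) (auto simp: nn_integral_multc)
  finally show ?thesis .
qed

text \<open>By \<open>target\<close>, one attempt succeeds with probability \<open>q\<close>, and an
  accepted proposal has law \<open>F\<close> if \<open>q > 0\<close>. Iterating the one-step
  recursion leaves weight \<open>(1 - q) ^ k\<close> for the untested proposal, whose law is
  \<open>P\<close>.\<close>

lemma rejection_distr:
  assumes P: "prob_space P" and F: "prob_space F" and sets_F: "sets F = sets P"
    and a[measurable]: "a \<in> borel_measurable P"
    and a01: "\<And>x. 0 \<le> a x" "\<And>x. a x \<le> 1" and q: "0 \<le> q" "q \<le> 1"
    and target: "\<And>A. A \<in> sets P \<Longrightarrow> (\<integral>\<^sup>+x\<in>A. ennreal (a x) \<partial>P) = ennreal q * emeasure F A"
    and A[measurable]: "A \<in> sets P"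
  shows "emeasure (distr (\<Pi>\<^sub>M i\<in>UNIV. P \<Otimes>\<^sub>M unif01) P (rejection (\<lambda>(x, u). u \<le> a x) k)) A =
    ennreal (1 - (1 - q) ^ k) * emeasure F A + ennreal ((1 - q) ^ k) * emeasure P A"
proof -
  interpret P: prob_space P by fact
  interpret F: prob_space F by fact
  have space_F: "space F = space P" by (rule sets_eq_imp_space_eq[OF sets_F])
  have p: "(\<integral>\<^sup>+x. ennreal (1 - a x) \<partial>P) = ennreal (1 - q)"
  proof -
    have "(\<integral>\<^sup>+x. ennreal (a x) \<partial>P) = (\<integral>\<^sup>+x\<in>space P. ennreal (a x) \<partial>P)"
      by (intro nn_integral_cong) auto
    also have "\<dots> = ennreal q" using target[of "space P"] F.emeasure_space_1 space_F by simp
    finally have q_eq: "(\<integral>\<^sup>+x. ennreal (a x) \<partial>P) = ennreal q" .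
    have "(\<integral>\<^sup>+x. ennreal (1 - a x) \<partial>P) = (\<integral>\<^sup>+x. 1 - ennreal (a x) \<partial>P)"
      using a01 by (intro nn_integral_cong) (simp add: ennreal_minus flip: ennreal_1)
    also have "\<dots> = (\<integral>\<^sup>+x. 1 \<partial>P) - (\<integral>\<^sup>+x. ennreal (a x) \<partial>P)"
      using a01 q_eq by (intro nn_integral_diff) auto
    also have "\<dots> = ennreal (1 - q)"
      using q P.emeasure_space_1 ennreal_minus[of q 1] by (simp add: q_eq)
    finally show ?thesis .
  qed
  show ?thesis
  proof (induction k)
    case 0
    interpret U: prob_space unif01 by (rule prob_space_unif01)
    interpret PU: pair_prob_space P unif01 ..
    interpret S: sequence_space "P \<Otimes>\<^sub>M unif01" ..
    have "distr S.S P (\<lambda>w. fst (w 0)) = distr (distr S.S (P \<Otimes>\<^sub>M unif01) (\<lambda>w. w 0)) P fst"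
      by (subst distr_distr) (auto simp: o_def)
    also have "\<dots> = distr (P \<Otimes>\<^sub>M unif01) P fst" by (subst S.PiM_component) auto
    also have "\<dots> = P" by (rule U.distr_pair_fst)
    finally show ?case by (simp add: fun_eq_iff cong: distr_cong)
  next
    case (Suc k)
    \<comment> \<open>The weights are rearranged in the reals, where subtraction is not
      truncated.\<close>
    define F' where "F' = measure F A"
    define P' where "P' = measure P A"
    have eq: "emeasure F A = ennreal F'" "emeasure P A = ennreal P'" "F' \<ge> 0" "P' \<ge> 0"
      by (auto simp: F'_def P'_def F.emeasure_eq_measure P.emeasure_eq_measure)
    have pk: "(1 - q) ^ k \<le> 1" "(1 - q) ^ k \<ge> 0" using q by (auto intro: power_le_one)
    define r where "r = (1 - q) ^ k"
    have nonneg: "0 \<le> 1 - q" "0 \<le> r" "0 \<le> 1 - r" "0 \<le> (1 - q) * r" "0 \<le> 1 - (1 - q) * r"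
      using q pk mult_le_one[of "1 - q" r] by (auto simp: r_def)
    have "ennreal q * ennreal F' + ennreal (1 - q) * (ennreal (1 - r) * ennreal F' + ennreal r * ennreal P')
      = ennreal (q * F' + (1 - q) * ((1 - r) * F' + r * P'))"
      using nonneg q eq(3,4)
      by (simp only: ennreal_mult ennreal_plus mult_nonneg_nonneg add_nonneg_nonneg)
    also have "q * F' + (1 - q) * ((1 - r) * F' + r * P') = (1 - (1 - q) * r) * F' + (1 - q) * r * P'"
      by (simp add: algebra_simps)
    also have "ennreal \<dots> = ennreal (1 - (1 - q) * r) * ennreal F' + ennreal ((1 - q) * r) * ennreal P'"
      using nonneg eq(3,4) by (simp only: ennreal_mult ennreal_plus mult_nonneg_nonneg)
    finally show ?case
      unfolding rejection_distr_step[OF P a a01 A] Suc target[OF A] p eq(1,2) by (simp add: r_def)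
  qed
qed

section \<open>Gibbs measures on the cube\<close>

lemma cube_eq_cbox: "(cube :: (real ^ 'd) set) = cbox 0 1"
  by (auto simp: cube_def mem_box_cart)

lemma cube_measurable [measurable]: "(cube :: (real ^ 'd) set) \<in> sets borel"
  by (simp add: cube_eq_cbox)

lemma emeasure_cube: "emeasure lborel (cube :: (real ^ 'd) set) = 1"
proof -
  have one: "(1 :: real ^ 'd) \<bullet> b = 1" if "b \<in> Basis" for b
    using that by (auto simp: Basis_vec_def inner_axis)
  then show ?thesis
    unfolding cube_eq_cbox by (subst emeasure_lborel_cbox) auto
qed

lemma integrable_cube_exp:
  fixes f :: "real ^ 'd \<Rightarrow> real"
  assumes [measurable]: "f \<in> borel_measurable borel" and b: "\<And>x. \<bar>f x\<bar> \<le> b"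
  shows "integrable lborel (\<lambda>x. indicator cube x * exp (f x))"
proof (rule Bochner_Integration.integrable_bound)
  show "integrable lborel (\<lambda>x :: real ^ 'd. indicator cube x * exp b)"
    by (auto simp: emeasure_cube)
  show "AE x :: real ^ 'd in lborel. norm (indicator cube x * exp (f x)) \<le> norm (indicator cube x * exp b)"
    using b by (auto simp: indicator_def abs_le_iff)
qed measurable

lemma Zf_eq: "Zf f = (\<integral>x. indicator cube x * exp (f x) \<partial>lborel)"
  by (simp add: Zf_def set_lebesgue_integral_def)

lemma Zf_le:
  fixes f g :: "real ^ 'd \<Rightarrow> real"
  assumes f: "f \<in> borel_measurable borel" "\<And>x. \<bar>f x\<bar> \<le> b"
    and g: "g \<in> borel_measurable borel" "\<And>x. \<bar>g x\<bar> \<le> b"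
    and fg: "\<And>x. f x \<le> g x + \<epsilon>"
  shows "Zf f \<le> exp \<epsilon> * Zf g"
proof -
  have "Zf f \<le> (\<integral>x. exp \<epsilon> * (indicator cube x * exp (g x)) \<partial>lborel)"
    unfolding Zf_eq
    using fg by (intro integral_mono integrable_cube_exp[OF f] integrable_mult_right integrable_cube_exp[OF g])
      (auto simp: indicator_def add.commute simp flip: exp_add)
  then show ?thesis by (simp add: Zf_eq)
qed

text \<open>Comparison with the zero potential, whose partition function is the volume 1 of the
  cube.\<close>

lemma Zf_pos:
  fixes f :: "real ^ 'd \<Rightarrow> real"
  assumes f: "f \<in> borel_measurable borel" "\<And>x. \<bar>f x\<bar> \<le> b"
  shows "Zf f > 0"
proof -
  have "0 \<le> b" using f(2)[of 0] by linarith
  moreover have "0 \<le> f x + b" for x using f(2)[of x] by linarith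
  ultimately have "Zf (\<lambda>_ :: real ^ 'd. 0) \<le> exp b * Zf f"
    using f by (intro Zf_le[of _ b]) auto
  moreover have "Zf (\<lambda>_ :: real ^ 'd. 0) = 1"
    by (simp add: Zf_eq measure_def emeasure_cube)
  ultimately have "0 < exp b * Zf f" by simp
  then show ?thesis by (simp add: zero_less_mult_iff)
qed

section \<open>Density ratios of Gibbs measures\<close>

lemma sets_Pf [measurable_cong, simp]: "sets (Pf f) = sets borel"
  by (simp add: Pf_def)

lemma space_Pf [simp]: "space (Pf f) = UNIV"
  by (simp add: Pf_def)

lemma Pf_cong:
  assumes "\<And>x. x \<in> cube \<Longrightarrow> f x = g x"
  shows "Pf f = Pf g"
proof -
  have eq: "indicator cube x * exp (f x) = indicator cube x * exp (g x)" for x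
    using assms by (auto simp: indicator_def)
  show ?thesis unfolding Pf_def Zf_eq eq ..
qed

lemma prob_space_Pf:
  fixes f :: "real ^ 'd \<Rightarrow> real"
  assumes f: "f \<in> borel_measurable borel" "\<And>x. \<bar>f x\<bar> \<le> b"
  shows "prob_space (Pf f)"
proof
  note [measurable] = f(1)
  have "emeasure (Pf f) (space (Pf f)) = (\<integral>\<^sup>+x. ennreal (indicator cube x * exp (f x) / Zf f) \<partial>lborel)"
    by (simp add: Pf_def emeasure_density)
  also have "\<dots> = ennreal (\<integral>x. indicator cube x * exp (f x) / Zf f \<partial>lborel)"
    using Zf_pos[OF f] integrable_cube_exp[OF f] by (intro nn_integral_eq_integral) auto
  also have "\<dots> = 1" using Zf_pos[OF f] by (simp add: Zf_eq)
  finally show "emeasure (Pf f) (space (Pf f)) = 1" .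
qed

lemma AE_Pf_cube:
  fixes f :: "real ^ 'd \<Rightarrow> real"
  assumes [measurable]: "f \<in> borel_measurable borel"
  shows "AE x in Pf f. x \<in> cube"
  unfolding Pf_def by (subst AE_density) (auto intro!: AE_I2 simp: indicator_def)

text \<open>Used in both directions: to see that accepted proposals follow the target law, and to
  express the fallback law relative to the target.\<close>

lemma Pf_eq_density_Pf:
  fixes f g :: "real ^ 'd \<Rightarrow> real"
  assumes f: "f \<in> borel_measurable borel" "\<And>x. \<bar>f x\<bar> \<le> b"
    and g: "g \<in> borel_measurable borel" "\<And>x. \<bar>g x\<bar> \<le> b"
  shows "Pf g = density (Pf f) (\<lambda>x. ennreal (exp (g x - f x) * (Zf f / Zf g)))"
proof -
  note [measurable] = f(1) g(1)
  have "ennreal (indicator cube x * exp (f x) / Zf f) * ennreal (exp (g x - f x) * (Zf f / Zf g)) =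
      ennreal (indicator cube x * exp (g x) / Zf g)" for x
    using Zf_pos[OF f] Zf_pos[OF g] by (subst ennreal_mult[symmetric]) (auto simp: exp_diff)
  then show ?thesis unfolding Pf_def by (subst density_density_eq) auto
qed

text \<open>A perturbation of size \<open>\<epsilon>\<close> changes the potential and the log-partition function by at most
  \<open>\<epsilon>\<close> each, hence the log-density ratio by \<open>2 * \<epsilon>\<close>.\<close>
lemma Pf_ratio_bounds:
  fixes f g :: "real ^ 'd \<Rightarrow> real"
  assumes f: "f \<in> borel_measurable borel" "\<And>x. \<bar>f x\<bar> \<le> b"
    and g: "g \<in> borel_measurable borel" "\<And>x. \<bar>g x\<bar> \<le> b"
    and fg: "\<And>x. \<bar>f x - g x\<bar> \<le> \<epsilon>"
  shows "exp (- 2 * \<epsilon>) \<le> exp (g x - f x) * (Zf f / Zf g)"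
    and "exp (g x - f x) * (Zf f / Zf g) \<le> exp (2 * \<epsilon>)"
    and "exp (- \<epsilon>) \<le> Zf f / Zf g" and "Zf f / Zf g \<le> exp \<epsilon>"
proof -
  note Z = Zf_pos[OF f] Zf_pos[OF g]
  have le: "f x \<le> g x + \<epsilon>" "g x \<le> f x + \<epsilon>" for x using fg[of x] by linarith+
  show 1: "exp (- \<epsilon>) \<le> Zf f / Zf g"
    using Zf_le[OF g f le(2)] Z by (simp add: exp_minus field_simps)
  show 2: "Zf f / Zf g \<le> exp \<epsilon>"
    using Zf_le[OF f g le(1)] Z by (simp add: field_simps)
  have "exp (- \<epsilon>) * exp (- \<epsilon>) \<le> exp (g x - f x) * (Zf f / Zf g)"
    using le(1)[of x] by (intro mult_mono 1) auto
  then show "exp (- 2 * \<epsilon>) \<le> exp (g x - f x) * (Zf f / Zf g)"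
    by (simp flip: exp_add)
  have "exp (g x - f x) * (Zf f / Zf g) \<le> exp \<epsilon> * exp \<epsilon>"
    using le(2)[of x] Z by (intro mult_mono 2) auto
  then show "exp (g x - f x) * (Zf f / Zf g) \<le> exp (2 * \<epsilon>)"
    by (simp flip: exp_add)
qed

text \<open>The distance involves the derivative of \<open>P\<close> with respect to
  \<open>Q\<close>, which is \<open>1 / y\<close>; taking the reciprocal does not change the
  absolute logarithm. Positivity of \<open>y\<close> gives absolute continuity both ways.\<close>

lemma D_suplog_density_le:
  assumes P: "prob_space P" and y[measurable]: "y \<in> borel_measurable P" and pos: "\<And>x. 0 < y x"
    and Q: "Q = density P (\<lambda>x. ennreal (y x))" and fin: "prob_space Q"
    and le: "\<And>x. \<bar>ln (y x)\<bar> \<le> \<delta>"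
  shows "D_suplog P Q \<le> ereal \<delta>"
proof -
  interpret Q: prob_space Q by fact
  have sets_Q[measurable_cong]: "sets Q = sets P" by (simp add: Q)
  have P_eq: "density Q (\<lambda>x. ennreal (1 / y x)) = P"
  proof -
    have one: "ennreal (y x) * ennreal (1 / y x) = 1" for x
      using pos[of x] by (subst ennreal_mult[symmetric]) (auto simp: less_imp_le)
    show ?thesis unfolding Q by (subst density_density_eq) (simp_all add: one density_1)
  qed
  have [measurable]: "y \<in> borel_measurable Q" by measurable
  have ac: "absolutely_continuous Q P" "absolutely_continuous P Q"
    using absolutely_continuousI_density[of "\<lambda>x. ennreal (1 / y x)" Q]
      absolutely_continuousI_density[of "\<lambda>x. ennreal (y x)" P] P_eq Q by auto
  have "AE x in Q. ennreal (1 / y x) = RN_deriv Q P x"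
    by (rule Q.RN_deriv_unique[OF _ P_eq]) measurable
  then have "AE x in Q. ereal \<bar>ln (enn2real (RN_deriv Q P x))\<bar> \<le> ereal \<delta>"
  proof eventually_elim
    case (elim x)
    have "enn2real (RN_deriv Q P x) = 1 / y x" using pos[of x] by (simp flip: elim)
    then show ?case using le[of x] pos[of x] by (simp add: ln_div)
  qed
  then show ?thesis using ac unfolding D_suplog_def by (auto intro!: esssup_I)
qed

text \<open>A convex combination of 1 and \<open>s\<close> stays in the interval from
  \<open>exp (- t)\<close> to \<open>exp t\<close>, which contains both.\<close>

lemma abs_ln_mixture_le:
  fixes s :: real
  assumes c: "0 \<le> c" "c \<le> 1" and s: "exp (- t) \<le> s" "s \<le> exp t" and t: "0 \<le> t"
  shows "0 < (1 - c) + c * s" "\<bar>ln ((1 - c) + c * s)\<bar> \<le> t"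
proof -
  let ?y = "(1 - c) + c * s"
  have e: "exp (- t) \<le> 1" "1 \<le> exp t" using t by auto
  have "exp (- t) = (1 - c) * exp (- t) + c * exp (- t)" by (simp add: algebra_simps)
  also have "\<dots> \<le> (1 - c) * 1 + c * s" using c s e by (intro add_mono mult_left_mono) auto
  finally have lo: "exp (- t) \<le> ?y" by simp
  have "(1 - c) * 1 + c * s \<le> (1 - c) * exp t + c * exp t"
    using c s e by (intro add_mono mult_left_mono) auto
  then have hi: "?y \<le> exp t" by (simp add: algebra_simps)
  show pos: "0 < ?y" using lo exp_gt_zero[of "- t"] by linarith
  show "\<bar>ln ?y\<bar> \<le> t"
    using lo hi pos ln_ge_iff[of ?y "- t"] ln_le_cancel_iff[of ?y "exp t"] by (simp add: abs_le_iff)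
qed

text \<open>The mixture is \<open>1 + c * (s - 1)\<close> with \<open>s - 1\<close> of order
  \<open>t\<close>, so its logarithm is of order \<open>c * t\<close>. The gain over the previous
  bound is the factor \<open>c\<close>, the weight of the fallback law.\<close>

lemma abs_ln_mixture_le_small:
  fixes s :: real
  assumes c: "0 \<le> c" "c \<le> 1" and s: "exp (- t) \<le> s" "s \<le> exp t" and t: "0 \<le> t" "t \<le> 1"
  shows "\<bar>ln ((1 - c) + c * s)\<bar> \<le> 6 * (c * t)"
proof -
  let ?y = "(1 - c) + c * s"
  note y = abs_ln_mixture_le[OF c s t(1)]
  have "exp t \<le> 1 + t + t\<^sup>2" using t by (rule exp_bound)
  moreover have "t\<^sup>2 \<le> t" using t by (simp add: power2_eq_square mult_left_le)
  ultimately have hi: "s - 1 \<le> 2 * t" using s by linarith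
  have lo: "1 - s \<le> t" using exp_ge_add_one_self[of "- t"] s by linarith
  have "ln ?y \<le> ?y - 1" using y(1) by (rule ln_le_minus_one)
  also have "\<dots> = c * (s - 1)" by (simp add: algebra_simps)
  also have "\<dots> \<le> c * (2 * t)" using hi c by (intro mult_left_mono) auto
  also have "\<dots> \<le> 6 * (c * t)" using c t by simp
  finally have 1: "ln ?y \<le> 6 * (c * t)" .
  \<comment> \<open>The lower bound for the logarithm comes from
    \<open>ln (1 / y) \<le> 1 / y - 1\<close>, which needs \<open>1 / y\<close> bounded; here it is
    at most \<open>exp 1 \<le> 3\<close>.\<close>
  have "exp (- 1) \<le> exp (ln ?y)" using y(2) t by simp
  then have "exp (- 1) \<le> ?y" using y(1) by simp
  then have "1 / ?y \<le> 1 / exp (- 1)" by (intro divide_left_mono) (use y(1) in auto)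
  then have inv: "1 / ?y \<le> 3" using exp_le by (simp add: exp_minus inverse_eq_divide)
  have "- ln ?y = ln (1 / ?y)" using y(1) by (simp add: ln_div)
  also have "\<dots> \<le> 1 / ?y - 1" using y(1) by (intro ln_le_minus_one) auto
  also have "\<dots> = (c * (1 - s)) * (1 / ?y)" using y(1) by (simp add: field_simps)
  also have "\<dots> \<le> (c * t) * (1 / ?y)" using lo c y(1) by (intro mult_right_mono mult_left_mono) auto
  also have "\<dots> \<le> (c * t) * 3" using inv c t by (intro mult_left_mono) auto
  also have "\<dots> \<le> 6 * (c * t)" using c t by simp
  finally show ?thesis using 1 by linarith
qed

text \<open>The shift by \<open>\<epsilon>\<close> makes the acceptance probability at most 1. The
  output has density \<open>(1 - c) + c * s\<close> with respect to \<open>Pf f\<close>, where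
  \<open>c\<close> is the probability that all \<open>k\<close> attempts fail and \<open>s\<close>
  is the density of \<open>Pf g\<close>. The two bounds on the logarithm of a mixture then apply
  with \<open>t = 2 * \<epsilon>\<close>.\<close>

lemma D_suplog_rejection_le:
  fixes f g :: "real ^ 'd \<Rightarrow> real" and k :: nat
  assumes f: "f \<in> borel_measurable borel" "\<And>x. \<bar>f x\<bar> \<le> b"
    and g: "g \<in> borel_measurable borel" "\<And>x. \<bar>g x\<bar> \<le> b"
    and fg: "\<And>x. \<bar>f x - g x\<bar> \<le> \<epsilon>"
  defines "Q \<equiv> distr (\<Pi>\<^sub>M i\<in>UNIV. Pf g \<Otimes>\<^sub>M unif01) lborel (rejection (\<lambda>(x, u). u \<le> exp (f x - g x - \<epsilon>)) k)"
  shows "AE x in Q. x \<in> cube"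
    and "D_suplog (Pf f) Q \<le> ereal (2 * \<epsilon>)"
    and "2 * \<epsilon> \<le> 1 \<Longrightarrow> D_suplog (Pf f) Q \<le> ereal (6 * (2 * \<epsilon>) ^ Suc k)"
proof -
  note [measurable] = f(1) g(1)
  note Z = Zf_pos[OF f] Zf_pos[OF g]
  interpret G: prob_space "Pf g" by (rule prob_space_Pf[OF g])
  have \<epsilon>: "0 \<le> \<epsilon>" using fg[of 0] by linarith
  \<comment> \<open>\<open>q\<close> is the acceptance probability of one attempt, the integral of
    \<open>exp (f - g - \<epsilon>)\<close> against \<open>Pf g\<close>.\<close>
  define q where "q = exp (- \<epsilon>) * (Zf f / Zf g)"
  have q_ge: "exp (- 2 * \<epsilon>) \<le> q"
    using mult_left_mono[OF Pf_ratio_bounds(3)[OF f g fg], of "exp (- \<epsilon>)"] by (simp add: q_def flip: exp_add)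
  have q_le: "q \<le> 1"
    using mult_left_mono[OF Pf_ratio_bounds(4)[OF f g fg], of "exp (- \<epsilon>)"] by (simp add: q_def flip: exp_add)
  have q0: "0 \<le> q" using q_ge exp_ge_zero order.trans by blast
  define c where "c = (1 - q) ^ k"
  have c: "0 \<le> c" "c \<le> 1" using q0 q_le by (auto simp: c_def power_le_one)
  \<comment> \<open>One attempt fails with probability
    \<open>1 - q \<le> 1 - exp (- 2 * \<epsilon>) \<le> 2 * \<epsilon>\<close>.\<close>
  have c_le: "c \<le> (2 * \<epsilon>) ^ k"
    unfolding c_def using q_le q_ge exp_ge_add_one_self[of "- 2 * \<epsilon>"] by (intro power_mono) linarith+
  define s where "s x = exp (g x - f x) * (Zf f / Zf g)" for x
  have [measurable]: "s \<in> borel_measurable borel" unfolding s_def by measurable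
  have s: "exp (- (2 * \<epsilon>)) \<le> s x" "s x \<le> exp (2 * \<epsilon>)" for x
    using Pf_ratio_bounds(1,2)[OF f g fg, of x] by (auto simp: s_def)
  have s_pos: "0 \<le> s x" for x using Z by (simp add: s_def)
  define y where "y x = (1 - c) + c * s x" for x
  have [measurable]: "y \<in> borel_measurable borel" unfolding y_def by measurable
  have target: "(\<integral>\<^sup>+x\<in>A. ennreal (exp (f x - g x - \<epsilon>)) \<partial>Pf g) = ennreal q * emeasure (Pf f) A"
    if "A \<in> sets (Pf g)" for A
  proof -
    have [measurable]: "A \<in> sets borel" using that by simp
    have eq: "ennreal (exp (f x - g x - \<epsilon>)) = ennreal q * ennreal (exp (f x - g x) * (Zf g / Zf f))" for x
      using Z by (subst ennreal_mult[symmetric]) (auto simp: q_def exp_diff exp_minus exp_add field_simps)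
    have "(\<integral>\<^sup>+x\<in>A. ennreal (exp (f x - g x - \<epsilon>)) \<partial>Pf g)
      = ennreal q * (\<integral>\<^sup>+x\<in>A. ennreal (exp (f x - g x) * (Zf g / Zf f)) \<partial>Pf g)"
      unfolding eq by (subst nn_integral_cmult[symmetric]) (auto simp: mult_ac)
    also have "(\<integral>\<^sup>+x\<in>A. ennreal (exp (f x - g x) * (Zf g / Zf f)) \<partial>Pf g) = emeasure (Pf f) A"
      by (subst Pf_eq_density_Pf[OF g f], subst emeasure_density) auto
    finally show ?thesis .
  qed
  have le: "f x - g x - \<epsilon> \<le> 0" for x using fg[of x] by linarith
  have Q_eq: "Q = density (Pf f) (\<lambda>x. ennreal (y x))"
  proof (rule measure_eqI)
    fix A assume "A \<in> sets Q"
    then have A[measurable]: "A \<in> sets borel" by (simp add: Q_def)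
    have "Q = distr (\<Pi>\<^sub>M i\<in>UNIV. Pf g \<Otimes>\<^sub>M unif01) (Pf g) (rejection (\<lambda>(x, u). u \<le> exp (f x - g x - \<epsilon>)) k)"
      unfolding Q_def by (rule distr_cong) auto
    then have "emeasure Q A = ennreal (1 - c) * emeasure (Pf f) A + ennreal c * emeasure (Pf g) A"
      unfolding c_def
      by (simp only:) (rule rejection_distr[OF prob_space_Pf[OF g] prob_space_Pf[OF f] _ _ _ _ q0 q_le target],
        use le in auto)
    also have "emeasure (Pf g) A = (\<integral>\<^sup>+x. ennreal (s x) * indicator A x \<partial>Pf f)"
      unfolding s_def by (subst Pf_eq_density_Pf[OF f g], subst emeasure_density) auto
    also have "ennreal (1 - c) * emeasure (Pf f) A + ennreal c * \<dots> =
      (\<integral>\<^sup>+x. ennreal (1 - c) * indicator A x + ennreal c * (ennreal (s x) * indicator A x) \<partial>Pf f)"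
      by (subst nn_integral_add) (auto simp: nn_integral_cmult)
    also have "\<dots> = (\<integral>\<^sup>+x. ennreal (y x) * indicator A x \<partial>Pf f)"
      using c s_pos by (intro nn_integral_cong) (auto simp: y_def indicator_def ennreal_mult ennreal_plus)
    also have "\<dots> = emeasure (density (Pf f) (\<lambda>x. ennreal (y x))) A"
      by (subst emeasure_density) auto
    finally show "emeasure Q A = emeasure (density (Pf f) (\<lambda>x. ennreal (y x))) A" .
  qed (simp add: Q_def)
  show "AE x in Q. x \<in> cube"
    unfolding Q_eq using AE_Pf_cube[OF f(1)] by (subst AE_density) auto
  interpret U: prob_space unif01 by (rule prob_space_unif01)
  interpret PU: pair_prob_space "Pf g" unif01 ..
  interpret S: sequence_space "Pf g \<Otimes>\<^sub>M unif01" ..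
  have "rejection (\<lambda>(x, u). u \<le> exp (f x - g x - \<epsilon>)) k \<in> measurable S.S (Pf g)"
    by (rule measurable_rejection) measurable
  then have "rejection (\<lambda>(x, u). u \<le> exp (f x - g x - \<epsilon>)) k \<in> measurable S.S lborel"
    by (subst (asm) measurable_cong_sets[OF refl, of _ lborel]) auto
  then have prob_Q: "prob_space Q" unfolding Q_def by (rule S.P.prob_space_distr)
  have y: "0 < y x" "\<bar>ln (y x)\<bar> \<le> 2 * \<epsilon>" for x
    unfolding y_def using abs_ln_mixture_le[OF c s] \<epsilon> by auto
  show "D_suplog (Pf f) Q \<le> ereal (2 * \<epsilon>)"
    by (rule D_suplog_density_le[OF prob_space_Pf[OF f] _ y(1) Q_eq prob_Q y(2)]) simp
  assume small: "2 * \<epsilon> \<le> 1"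
  have "\<bar>ln (y x)\<bar> \<le> 6 * (2 * \<epsilon>) ^ Suc k" for x
  proof -
    have "\<bar>ln (y x)\<bar> \<le> 6 * (c * (2 * \<epsilon>))"
      unfolding y_def using abs_ln_mixture_le_small[OF c s _ small] \<epsilon> by auto
    also have "\<dots> \<le> 6 * ((2 * \<epsilon>) ^ k * (2 * \<epsilon>))"
      using c_le \<epsilon> by (intro mult_left_mono mult_right_mono) auto
    finally show ?thesis by (simp add: mult_ac)
  qed
  then show "D_suplog (Pf f) Q \<le> ereal (6 * (2 * \<epsilon>) ^ Suc k)"
    by (intro D_suplog_density_le[OF prob_space_Pf[OF f] _ y(1) Q_eq prob_Q]) simp
qed

section \<open>The algorithm\<close>

text \<open>Allows the test to read a recorded function value from the stream instead of calling the
  function. The tests need to agree only for \<open>j < k\<close>, since the fallback is never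
  tested.\<close>

lemma rejection_cong:
  assumes "\<And>j. fst (w' j) = fst (w j)" "\<And>j. j < k \<Longrightarrow> acc' (w' j) = acc (w j)"
  shows "rejection acc' k w' = rejection acc k w"
  using assms
proof (induction k arbitrary: w w')
  case (Suc k)
  have "rejection acc' k (\<lambda>i. w' (Suc i)) = rejection acc k (\<lambda>i. w (Suc i))"
    using Suc.prems by (intro Suc.IH) auto
  then show ?case using Suc.prems by simp
qed simp

text \<open>Members of \<open>Fclass\<close> are arbitrary, possibly non-measurable, outside the cube; composing with
  \<open>to_cube\<close> makes them Borel without changing \<open>Pf\<close> or any evaluation.\<close>
definition to_cube :: "real ^ 'd \<Rightarrow> real ^ 'd" where
  "to_cube x = (if x \<in> cube then x else 0)"

lemma to_cube_in_cube: "to_cube x \<in> cube"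
  by (simp add: to_cube_def cube_def)

lemma to_cube_id: "x \<in> cube \<Longrightarrow> to_cube x = x"
  by (simp add: to_cube_def)

lemma to_cube_measurable [measurable]: "to_cube \<in> borel_measurable borel"
  unfolding to_cube_def[abs_def] by measurable

lemma Fclass_to_cube_measurable:
  fixes f :: "real ^ 'd \<Rightarrow> real"
  assumes "f \<in> Fclass m B"
  shows "(\<lambda>x. f (to_cube x)) \<in> borel_measurable borel"
proof -
  have [measurable]: "(\<lambda>x. indicator cube x *\<^sub>R f x) \<in> borel_measurable borel"
    by (rule borel_measurable_continuous_on_indicator[OF _ Fclass_continuous[OF assms]]) measurable
  have "(\<lambda>x. f (to_cube x)) = (\<lambda>x. indicator cube x *\<^sub>R f x + indicator (- cube) x * f 0)"
    by (auto simp: to_cube_def indicator_def)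
  then show ?thesis by (simp only:) measurable
qed

text \<open>The sample space is prescribed as real sequences, while the algorithm needs a stream of
  proposals for every integer list. This amounts to countably many reals; injectivity suffices
  because the measure will be transported along the coding.\<close>

lemma ex_inj_source_omega: "\<exists>e :: (int list \<Rightarrow> nat \<Rightarrow> (real ^ 'd) \<times> real) \<Rightarrow> omega. inj e"
proof -
  obtain h :: "'d \<Rightarrow> nat" where h: "inj h"
    using finite_imp_inj_to_nat_seg[of "UNIV :: 'd set"] by auto
  \<comment> \<open>The triple \<open>(z, j, l)\<close> addresses entry \<open>j\<close> of stream
    \<open>z\<close>: \<open>l = 0\<close> is the uniform variable, \<open>l = Suc (h i)\<close> is
    coordinate \<open>i\<close> of the proposal.\<close>
  define e :: "(int list \<Rightarrow> nat \<Rightarrow> (real ^ 'd) \<times> real) \<Rightarrow> omega" where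
    "e w = (\<lambda>i. case from_nat i of (z :: int list, j :: nat, l :: nat) \<Rightarrow>
      if l = 0 then snd (w z j) else fst (w z j) $ inv h (l - 1))" for w
  have "w = w'" if eq: "e w = e w'" for w w'
  proof (intro ext prod_eqI)
    fix z j
    show "snd (w z j) = snd (w' z j)"
      using fun_cong[OF eq, of "to_nat (z, j, 0 :: nat)"] by (simp add: e_def)
    show "fst (w z j) = fst (w' z j)"
      unfolding vec_eq_iff
    proof
      fix i
      show "fst (w z j) $ i = fst (w' z j) $ i"
        using fun_cong[OF eq, of "to_nat (z, j, Suc (h i))"] h by (simp add: e_def)
    qed
  qed
  then have "inj e" by (rule injI)
  then show ?thesis by blast
qed

text \<open>The values at \<open>xs\<close> select a candidate within \<open>\<epsilon>\<close> of
  \<open>f\<close>, and the remaining evaluations serve as acceptance tests for proposals drawn from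
  its Gibbs measure. All streams are part of \<open>\<omega>\<close>, so each evaluation point
  depends only on \<open>\<omega>\<close> and the values seen so far.\<close>

lemma ex_rejection_algorithm:
  fixes xs :: "(real ^ 'd) list" and n m :: nat
  assumes len: "length xs \<le> n" and xs: "set xs \<subseteq> cube" and B: "0 \<le> B" and \<delta>: "0 < \<delta>"
    and approx: "\<And>f g x. f \<in> Fclass m B \<Longrightarrow> g \<in> Fclass m B \<Longrightarrow>
      (\<forall>x\<in>set xs. \<bar>f x - g x\<bar> \<le> \<delta>) \<Longrightarrow> x \<in> cube \<Longrightarrow> \<bar>f x - g x\<bar> \<le> \<epsilon>"
  shows "\<exists>M \<psi> \<phi>. ad_stoch_alg n M \<psi> \<phi> \<and> (\<forall>f \<in> (Fclass m B :: (real ^ 'd \<Rightarrow> real) set).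
    D_suplog (Pf f) (alg_dist n M \<psi> \<phi> f) \<le> ereal (2 * \<epsilon>) \<and>
    (2 * \<epsilon> \<le> 1 \<longrightarrow> D_suplog (Pf f) (alg_dist n M \<psi> \<phi> f) \<le> ereal (6 * (2 * \<epsilon>) ^ Suc (n - length xs))))"
proof -
  define N where "N = length xs"
  define k where "k = n - N"
  have n: "n = N + k" using len by (simp add: k_def N_def)
  define key where "key f = map (\<lambda>x. \<lfloor>f x / \<delta>\<rfloor>) xs" for f :: "real ^ 'd \<Rightarrow> real"
  \<comment> \<open>Rounding the node values leaves countably many candidate potentials, so a single countable
    product of proposal streams serves every \<open>f\<close>. As the nodes are deterministic, the candidate used
    for a given \<open>f\<close> does not depend on \<open>\<omega>\<close>, and the choice by \<open>SOME\<close> is harmless for measurability.\<close>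
  define g0 where "g0 z = (if \<exists>g. g \<in> Fclass m B \<and> key g = z
    then SOME g. g \<in> Fclass m B \<and> key g = z else (\<lambda>_. 0))" for z
  define G where "G z x = g0 z (to_cube x)" for z x
  \<comment> \<open>The default 0 for keys attained by no member of the class keeps every
    \<open>G z\<close> bounded and measurable, so every factor of the product is a probability
    measure.\<close>
  have g0: "g0 z \<in> Fclass m B \<and> key (g0 z) = z \<or> g0 z = (\<lambda>_. 0)" for z
    using someI_ex[of "\<lambda>g. g \<in> Fclass m B \<and> key g = z"] by (auto simp: g0_def)
  have G_meas [measurable]: "G z \<in> borel_measurable borel" for z
    using g0[of z] Fclass_to_cube_measurable[of "g0 z"] by (auto simp: G_def[abs_def])
  have G_bound: "\<bar>G z x\<bar> \<le> B" for z x
    using g0[of z] Fclass_bound[of "g0 z" m B "to_cube x"] to_cube_in_cube B by (auto simp: G_def)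
  define S where "S z = (\<Pi>\<^sub>M i\<in>UNIV :: nat set. Pf (G z) \<Otimes>\<^sub>M unif01)" for z
  have prob_S: "prob_space (S z)" for z
  proof -
    interpret G: prob_space "Pf (G z)" by (rule prob_space_Pf[OF G_meas G_bound])
    interpret U: prob_space unif01 by (rule prob_space_unif01)
    interpret PU: pair_prob_space "Pf (G z)" unif01 ..
    interpret sequence_space "Pf (G z) \<Otimes>\<^sub>M unif01" ..
    show ?thesis unfolding S_def by (rule P.prob_space_axioms)
  qed
  define M' where "M' = (\<Pi>\<^sub>M z\<in>UNIV. S z)"
  have prob_M': "prob_space M'" unfolding M'_def by (rule prob_space_PiM[OF prob_S])
  have M'_S: "(\<lambda>w. w z) \<in> measurable M' (S z)" "distr M' (S z) (\<lambda>w. w z) = S z" for z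
    unfolding M'_def by (auto intro: distr_PiM_component[OF prob_S])
  obtain e :: "(int list \<Rightarrow> nat \<Rightarrow> (real ^ 'd) \<times> real) \<Rightarrow> omega" where e: "inj e"
    using ex_inj_source_omega by blast
  have inv_e [simp]: "inv e (e w) = w" for w using e by simp
  \<comment> \<open>The product measure is carried to the prescribed sample space along
    \<open>e\<close>; the algorithm recovers the streams by \<open>inv e\<close>.\<close>
  define M where "M = embed_measure M' e"
  define key_of where "key_of ys = map (\<lambda>v. \<lfloor>v / \<delta>\<rfloor>) (take N ys)" for ys
  \<comment> \<open>The key reads only the first \<open>N\<close> values, so the selected stream
    does not change as further values arrive.\<close>
  define \<psi> where "\<psi> i \<omega> ys =
    (if i < N then xs ! i else to_cube (fst (inv e \<omega> (key_of ys) (i - N))))" for i \<omega> ys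
  \<comment> \<open>The recorded value of \<open>f\<close> at proposal \<open>j\<close> is
    \<open>ys ! (N + j)\<close>. For \<open>j = k\<close> this index is out of range, but the
    fallback is returned without a test.\<close>
  define \<phi> where "\<phi> ys \<omega> = to_cube (rejection (\<lambda>(x, u, v). u \<le> exp (v - G (key_of ys) x - \<epsilon>)) k
    (\<lambda>j. (fst (inv e \<omega> (key_of ys) j), snd (inv e \<omega> (key_of ys) j), ys ! (N + j))))" for ys \<omega>
  define acc where "acc f = (\<lambda>(x, u). u \<le> exp (f (to_cube x) - G (key f) x - \<epsilon>))" for f :: "real ^ 'd \<Rightarrow> real"

  have info_nodes: "info \<psi> f \<omega> i = map f (take i xs)" if "i \<le> N" for f \<omega> i
    using that
  proof (induction i)
    case (Suc i)
    then show ?case by (simp add: \<psi>_def N_def take_Suc_conv_app_nth)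
  qed simp
  have key_of_info: "key_of (map f xs @ ys) = key f" for f ys
    by (simp add: key_of_def key_def N_def o_def)
  have info_proposals: "info \<psi> f (e w) (N + j) =
    map f xs @ map (\<lambda>i. f (to_cube (fst (w (key f) i)))) [0..<j]" for f w j
  proof (induction j)
    case 0
    then show ?case using info_nodes[of N f "e w"] by (simp add: N_def)
  next
    case (Suc j)
    then show ?case by (simp add: \<psi>_def key_of_info)
  qed
  \<comment> \<open>For fixed \<open>f\<close> the output depends on a single component of the
    product, the stream of index \<open>key f\<close>; both its measurability and its law follow
    from that component.\<close>
  have sample: "sample n \<psi> \<phi> f (e w) = to_cube (rejection (acc f) k (w (key f)))" for f w
    unfolding sample_def n info_proposals \<phi>_def key_of_info inv_e
    by (intro arg_cong[where f = to_cube] rejection_cong)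
      (auto simp: acc_def nth_append N_def split: prod.splits)
  have rej_meas: "rejection (acc f) k \<in> measurable (S (key f)) borel"
    if [measurable]: "(\<lambda>x. f (to_cube x)) \<in> borel_measurable borel" for f
  proof -
    have "rejection (acc f) k \<in> measurable (S (key f)) (Pf (G (key f)))"
      unfolding S_def acc_def by (rule measurable_rejection) measurable
    then show ?thesis by (subst (asm) measurable_cong_sets[OF refl, of _ borel]) auto
  qed
  have sample_meas: "sample n \<psi> \<phi> f \<in> measurable M borel"
    if "(\<lambda>x. f (to_cube x)) \<in> borel_measurable borel" for f
    unfolding M_def
  proof (rule measurable_embed_measure1)
    show "(\<lambda>w. sample n \<psi> \<phi> f (e w)) \<in> measurable M' borel"
      unfolding sample
      by (intro measurable_compose[OF _ to_cube_measurable] measurable_compose[OF M'_S(1) rej_meas[OF that]])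
  qed
  have e_meas: "e \<in> measurable M' M" unfolding M_def by (rule measurable_embed_measure2[OF e])
  have M_eq: "M = distr M' M e" unfolding M_def by (rule embed_measure_eq_distr[OF e])
  have "prob_space M"
    using prob_space.prob_space_distr[OF prob_M' e_meas] M_eq by simp
  then have alg: "ad_stoch_alg n M \<psi> \<phi>"
    unfolding ad_stoch_alg_def
  proof (intro conjI allI impI)
    show "\<psi> i \<omega> ys \<in> cube" for i \<omega> ys
      using xs by (auto simp: \<psi>_def N_def to_cube_in_cube)
    show "\<phi> ys \<omega> \<in> cube" for ys \<omega> by (simp add: \<phi>_def to_cube_in_cube)
    show "sample n \<psi> \<phi> f \<in> measurable M borel" if "f \<in> borel_measurable borel" for f
      by (rule sample_meas) (use that in measurable)
  qed
  have "D_suplog (Pf f) (alg_dist n M \<psi> \<phi> f) \<le> ereal (2 * \<epsilon>) \<and>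
    (2 * \<epsilon> \<le> 1 \<longrightarrow> D_suplog (Pf f) (alg_dist n M \<psi> \<phi> f) \<le> ereal (6 * (2 * \<epsilon>) ^ Suc k))"
    if f: "f \<in> Fclass m B" for f
  proof -
    define fc where "fc x = f (to_cube x)" for x
    have fc_meas: "fc \<in> borel_measurable borel"
      unfolding fc_def[abs_def] by (rule Fclass_to_cube_measurable[OF f])
    have fc_bound: "\<bar>fc x\<bar> \<le> B" for x
      unfolding fc_def by (rule Fclass_bound[OF f to_cube_in_cube])
    let ?g = "g0 (key f)"
    have g: "?g \<in> Fclass m B" "key ?g = key f"
      using f someI_ex[of "\<lambda>g. g \<in> Fclass m B \<and> key g = key f"] by (auto simp: g0_def)
    \<comment> \<open>Equal floors place both values, in units of \<open>\<delta>\<close>, in the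
      same unit interval.\<close>
    have "\<bar>f x - ?g x\<bar> \<le> \<delta>" if "x \<in> set xs" for x
    proof -
      have "\<lfloor>f x / \<delta>\<rfloor> = \<lfloor>?g x / \<delta>\<rfloor>" using g(2) that unfolding key_def by (auto simp: map_eq_conv)
      then have "\<bar>f x / \<delta> - ?g x / \<delta>\<bar> \<le> 1" by linarith
      then show ?thesis using \<delta> by (simp add: abs_divide flip: diff_divide_distrib)
    qed
    then have close: "\<bar>fc x - G (key f) x\<bar> \<le> \<epsilon>" for x
      unfolding fc_def G_def by (intro approx f g to_cube_in_cube) auto
    define Q where "Q = distr (S (key f)) lborel (rejection (acc f) k)"
    have Q_eq: "Q = distr (\<Pi>\<^sub>M i\<in>UNIV. Pf (G (key f)) \<Otimes>\<^sub>M unif01) lborel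
      (rejection (\<lambda>(x, u). u \<le> exp (fc x - G (key f) x - \<epsilon>)) k)"
      by (simp add: Q_def S_def acc_def fc_def)
    note bounds = D_suplog_rejection_le[OF fc_meas fc_bound G_meas G_bound close, of "k", folded Q_eq]
    have rej: "rejection (acc f) k \<in> measurable (S (key f)) lborel"
      using rej_meas fc_meas by (simp add: fc_def[abs_def])
    have "alg_dist n M \<psi> \<phi> f = distr (distr M' M e) lborel (sample n \<psi> \<phi> f)"
      using M_eq by (simp add: alg_dist_def)
    also have "\<dots> = distr M' lborel (\<lambda>w. to_cube (rejection (acc f) k (w (key f))))"
      using sample_meas fc_meas by (subst distr_distr[OF _ e_meas]) (auto simp: fc_def[abs_def] o_def sample)
    also have "\<dots> = distr (distr M' (S (key f)) (\<lambda>w. w (key f))) lborel (\<lambda>w. to_cube (rejection (acc f) k w))"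
      by (subst distr_distr[OF _ M'_S(1)]) (use rej in \<open>auto simp: o_def\<close>)
    also have "\<dots> = distr Q lborel to_cube"
      unfolding M'_S(2) Q_def by (subst distr_distr[OF _ rej]) (auto simp: o_def)
    \<comment> \<open>\<open>Q\<close> is concentrated on the cube, so forcing the output into the
      cube does not change its law.\<close>
    also have "\<dots> = distr Q lborel (\<lambda>x. x)"
      using bounds(1) by (intro distr_cong_AE) (auto simp: to_cube_id Q_def)
    also have "\<dots> = Q" by (rule distr_id2) (simp add: Q_def)
    finally have "alg_dist n M \<psi> \<phi> f = Q" .
    moreover have "Pf fc = Pf f" by (rule Pf_cong) (simp add: fc_def to_cube_id)
    ultimately show ?thesis using bounds(2,3) by simp
  qed
  then show ?thesis using alg unfolding k_def N_def by blast
qed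

theorem theorem9:
  fixes m :: nat
  assumes "m \<ge> 1"
  shows "\<exists>C C'. C > 0 \<and> C' > 0 \<and>
    (\<forall>(B::real) (n::nat). B > 0 \<and> n \<ge> 1 \<longrightarrow>
      (let d = real CARD('d); t = C * B * real n powr (- real m / d) in
        (t > 1 \<longrightarrow> err_ad_stoch n (Fclass m B :: (real ^ 'd \<Rightarrow> real) set)
                      \<le> ereal (C' * B * real n powr (- real m / d))) \<and>
        (t \<le> 1 \<longrightarrow> err_ad_stoch n (Fclass m B :: (real ^ 'd \<Rightarrow> real) set)
                      \<le> ereal (C' * t powr (real n / 2 + 1)))))"
proof -
  obtain c :: real where c: "c > 0" and nodes:
    "\<And>B n. B > 0 \<Longrightarrow> n \<ge> 1 \<Longrightarrow> \<exists>xs :: (real ^ 'd) list. 2 * length xs \<le> n \<and> set xs \<subseteq> cube \<and>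
      (\<forall>f \<in> Fclass m B. \<forall>g \<in> Fclass m B.
        (\<forall>x \<in> set xs. \<bar>f x - g x\<bar> \<le> B * real n powr (- real m / real CARD('d))) \<longrightarrow>
        (\<forall>x \<in> cube. \<bar>f x - g x\<bar> \<le> c * (B * real n powr (- real m / real CARD('d)))))"
    using Fclass_sampling_nodes[OF assms] by blast
  \<comment> \<open>With \<open>\<epsilon> = c * \<delta>\<close> this makes \<open>t\<close> equal
    to \<open>2 * \<epsilon>\<close>, the quantity in both error bounds. In \<open>C'\<close>, the
    value \<open>C\<close> is for the linear bound and 6 for the power bound.\<close>
  define C where "C = 2 * c"
  define C' where "C' = max 6 C"
  have "err_ad_stoch n (Fclass m B :: (real ^ 'd \<Rightarrow> real) set)
          \<le> ereal (C' * B * real n powr (- real m / real CARD('d)))"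
    "C * B * real n powr (- real m / real CARD('d)) \<le> 1 \<Longrightarrow>
        err_ad_stoch n (Fclass m B :: (real ^ 'd \<Rightarrow> real) set)
          \<le> ereal (C' * (C * B * real n powr (- real m / real CARD('d))) powr (real n / 2 + 1))"
    if B: "B > 0" and n: "n \<ge> 1" for B n
  proof -
    define \<delta> where "\<delta> = B * real n powr (- real m / real CARD('d))"
    define t where "t = C * \<delta>"
    have \<delta>: "\<delta> > 0" and t: "t > 0" using B n c by (simp_all add: \<delta>_def t_def C_def)
    have t_eq: "2 * (c * \<delta>) = t" by (simp add: t_def C_def)
    obtain xs :: "(real ^ 'd) list" where xs: "2 * length xs \<le> n" "set xs \<subseteq> cube"
      "\<forall>f \<in> Fclass m B. \<forall>g \<in> Fclass m B. (\<forall>x \<in> set xs. \<bar>f x - g x\<bar> \<le> \<delta>) \<longrightarrow>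
        (\<forall>x \<in> cube. \<bar>f x - g x\<bar> \<le> c * \<delta>)"
      using nodes[OF B n] unfolding \<delta>_def by blast
    obtain M \<psi> \<phi> where alg: "ad_stoch_alg n M \<psi> \<phi>"
      and err: "\<forall>f \<in> (Fclass m B :: (real ^ 'd \<Rightarrow> real) set). D_suplog (Pf f) (alg_dist n M \<psi> \<phi> f) \<le> ereal t \<and>
        (t \<le> 1 \<longrightarrow> D_suplog (Pf f) (alg_dist n M \<psi> \<phi> f) \<le> ereal (6 * t ^ Suc (n - length xs)))"
      using ex_rejection_algorithm[of xs n B \<delta> m "c * \<delta>"] xs B \<delta> unfolding t_eq by auto
    have err_le: "err_ad_stoch n (Fclass m B :: (real ^ 'd \<Rightarrow> real) set) \<le> r"
      if "\<And>f :: real ^ 'd \<Rightarrow> real. f \<in> Fclass m B \<Longrightarrow> D_suplog (Pf f) (alg_dist n M \<psi> \<phi> f) \<le> r" for r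
      unfolding err_ad_stoch_def
      by (rule INF_lower2[of "(M, \<psi>, \<phi>)"]) (use alg that in \<open>auto intro: SUP_least\<close>)
    have "t \<le> C' * \<delta>" unfolding t_def C'_def using \<delta> by (intro mult_right_mono) auto
    then show "err_ad_stoch n (Fclass m B :: (real ^ 'd \<Rightarrow> real) set)
          \<le> ereal (C' * B * real n powr (- real m / real CARD('d)))"
      using err by (intro err_le) (auto simp: \<delta>_def mult.assoc intro: order.trans)
    assume "C * B * real n powr (- real m / real CARD('d)) \<le> 1"
    then have t1: "t \<le> 1" by (simp add: t_def \<delta>_def mult.assoc)
    have "6 * t ^ Suc (n - length xs) = 6 * t powr real (Suc (n - length xs))"
      using t by (simp only: powr_realpow)
    \<comment> \<open>At least \<open>n / 2\<close> evaluations remain for rejection, and for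
      \<open>t \<le> 1\<close> a larger exponent gives a smaller power. The extra 1 comes from the
      closeness of the fallback law to the target.\<close>
    also have "\<dots> \<le> 6 * t powr (real n / 2 + 1)"
      using xs(1) t t1 by (intro mult_left_mono powr_mono') (auto simp: of_nat_diff)
    also have "\<dots> \<le> C' * t powr (real n / 2 + 1)"
      by (intro mult_right_mono) (auto simp: C'_def)
    finally have "6 * t ^ Suc (n - length xs) \<le> C' * t powr (real n / 2 + 1)" .
    then have "err_ad_stoch n (Fclass m B :: (real ^ 'd \<Rightarrow> real) set) \<le> ereal (C' * t powr (real n / 2 + 1))"
      using err t1 by (intro err_le) (auto elim!: ballE intro: order.trans)
    then show "err_ad_stoch n (Fclass m B :: (real ^ 'd \<Rightarrow> real) set)
          \<le> ereal (C' * (C * B * real n powr (- real m / real CARD('d))) powr (real n / 2 + 1))"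
      by (simp add: t_def \<delta>_def mult.assoc)
  qed
  moreover have "C > 0" "C' > 0" using c by (auto simp: C_def C'_def)
  ultimately show ?thesis
    unfolding Let_def by (intro exI[of _ C] exI[of _ C'] conjI allI impI) auto
qed

end
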